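(* Let $\mathcal G$ be an ultragraph. If $\mathcal G$ satisfies the graph-theoretic RFD conditions (B1)--(B4), then the complex ultragraph Leavitt path algebra $L_{\mathbb C}(\mathcal G)$ is $*$-residually finite-dimensional.
   Context: Ultragraphs. An ultragraph is a quadruple $\mathcal G=(G^0,\mathcal G^1,r,s)$ with $G^0$ a set of vertices, $\mathcal G^1$ a set of edges, $s:\mathcal G^1\to G^0$ and $r:\mathcal G^1\to\mathcal P(G^0)\setminus\{\emptyset\}$. $\mathcal G^0$ is the smallest collection of subsets of $G^0$ containing all singletons $\{v\}$ and all ranges $r(e)$ and closed under finite unions and finite intersections (with $\emptyset\in\mathcal G^0$). A path of length $n\ge1$ is a word $\alpha=e_1\cdots e_n$ of edges with $s(e_{i+1})\in r(e_i)$ for $1\le i<n$; $s(\alpha)=s(e_1)$, $r(\alpha)=r(e_n)$. A vertex $v$ is a sink if $s^{-1}(v)=\emptyset$, and regular if $0<|s^{-1}(v)|<\infty$. For $A\in\mathcal G^0$ let $\varepsilon(A)=\{e\in\mathcal G^1:s(e)\in A\}$; $A$ is an infinite emitter if $|\varepsilon(A)|=\infty$. $A\in\mathcal G^0$ is a minimal infinite emitter if $|\varepsilon(A)|=\infty$ and no proper subset $B\subsetneq A$ with $B\in\mathcal G^0$ is either an infinite emitter or an infinite set with $|\varepsilon(B)|<\infty$. $A\in\mathcal G^0$ is a minimal sink if $|A|=\infty$, $|\varepsilon(A)|<\infty$ and no proper subset $B\subsetneq A$ with $B\in\mathcal G^0$ is infinite. Terminal boundary sets. $\mathcal A\subseteq\mathcal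 G^0$ is the collection of all minimal infinite emitters, all minimal sinks, and all $\{v\}$ with $v$ a sink; its elements are terminal boundary sets. Cycles. A cycle is a path $c=e_1\cdots e_n$, $n\ge1$, with $s(e_1)\in r(e_n)$ and $s(e_1),\dots,s(e_n)$ distinct; the vertices on $c$ are the $s(e_i)$. An exit for $c$ is either an edge $f$ with $s(f)\in r(e_i)$ and $f\ne e_{i+1}$ for some $i$ (indices cyclic), or a sink $w\in r(e_i)$ for some $i$. Graph-theoretic RFD conditions. (B1) No infinite receivers: for every $v\in G^0$ the set $\{e\in\mathcal G^1:v\in r(e)\}$ is finite. (B2) No cycle has an exit. (B3) No infinite backward chains: there is no infinite sequence of distinct edges $e_1,e_2,e_3,\dots$ with $s(e_i)\in r(e_{i+1})$ for all $i\ge1$. (B4) Every $v\in G^0$ reaches a terminal boundary set (i.e. $\{v\}\in\mathcal A$, or there are a path $\alpha$ with $|\alpha|\ge1$, $s(\alpha)=v$, and $A\in\mathcal A$ with $A\subseteq r(\alpha)$) or reaches a cycle (i.e. $v$ lies on a cycle, or there is a path $\alpha$ with $|\alpha|\ge1$, $s(\alpha)=v$, such that $r(\alpha)$ contains a vertex lying on a cycle). Algebra. $L_{\mathbb C}(\mathcal G)$ is the universal $\mathbb C$-algebra generated by $\{s_e,s_e^*:e\in\mathcal G^1\}\cup\{p_A:A\in\mathcal G^0\}$ subject to: $p_\emptyset=0$, $p_Ap_B=p_{A\cap B}$, $p_{A\cup B}=p_A+p_B-p_{A\cap B}$; $p_{s(e)}s_e=s_ep_{r(e)}=s_e$ and $p_{r(e)}s_e^*=s_e^*p_{s(e)}=s_e^*$;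 $s_e^*s_f=\delta_{e,f}p_{r(e)}$; $p_v=\sum_{s(e)=v}s_es_e^*$ for every regular vertex $v$ (where $p_v:=p_{\{v\}}$). It is a complex $*$-algebra with the conjugate-linear involution fixing each $p_A$ and exchanging the generators $s_e$ and $s_e^*$. A complex $*$-algebra $A$ is $*$-residually finite-dimensional ($*$-RFD) if for every $0\ne a\in A$ there are a finite-dimensional Hilbert space $H$ and a $*$-homomorphism $\pi:A\to B(H)$ with $\pi(a)\ne0$. *)

theory Defs
  imports "HOL-Library.Poly_Mapping" "Jordan_Normal_Form.Schur_Decomposition"
begin

section \<open>Ultragraphs\<close>

record ('v, 'e) pre_ultragraph =
  verts :: "'v set"
  edges :: "'e set"
  src :: "'e \<Rightarrow> 'v"
  rng :: "'e \<Rightarrow> 'v set"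

locale ultragraph =
  fixes G :: "('v, 'e) pre_ultragraph"
  assumes src_in_verts: "e \<in> edges G \<Longrightarrow> src G e \<in> verts G"
    and rng_subset_verts: "e \<in> edges G \<Longrightarrow> rng G e \<subseteq> verts G"
    and rng_nonempty: "e \<in> edges G \<Longrightarrow> rng G e \<noteq> {}"

inductive_set gen_verts :: "('v, 'e) pre_ultragraph \<Rightarrow> 'v set set"
  for G :: "('v, 'e) pre_ultragraph" where
  gen_empty: "{} \<in> gen_verts G"
| gen_vertex: "v \<in> verts G \<Longrightarrow> {v} \<in> gen_verts G"
| gen_range: "e \<in> edges G \<Longrightarrow> rng G e \<in> gen_verts G"
| gen_Un: "A \<in> gen_verts G \<Longrightarrow> B \<in> gen_verts G \<Longrightarrow> A \<union> B \<in> gen_verts G"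
| gen_Int: "A \<in> gen_verts G \<Longrightarrow> B \<in> gen_verts G \<Longrightarrow> A \<inter> B \<in> gen_verts G"

definition out_edges :: "('v, 'e) pre_ultragraph \<Rightarrow> 'v set \<Rightarrow> 'e set" where
  "out_edges G A = {e \<in> edges G. src G e \<in> A}"

definition is_sink :: "('v, 'e) pre_ultragraph \<Rightarrow> 'v \<Rightarrow> bool" where
  "is_sink G v \<longleftrightarrow> v \<in> verts G \<and> out_edges G {v} = {}"

definition is_regular :: "('v, 'e) pre_ultragraph \<Rightarrow> 'v \<Rightarrow> bool" where
  "is_regular G v \<longleftrightarrow> v \<in> verts G \<and> finite (out_edges G {v}) \<and> out_edges G {v} \<noteq> {}"

definition is_path :: "('v, 'e) pre_ultragraph \<Rightarrow> 'e list \<Rightarrow> bool" where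
  "is_path G \<alpha> \<longleftrightarrow> \<alpha> \<noteq> [] \<and> set \<alpha> \<subseteq> edges G \<and>
     (\<forall>i. Suc i < length \<alpha> \<longrightarrow> src G (\<alpha> ! Suc i) \<in> rng G (\<alpha> ! i))"

definition path_src :: "('v, 'e) pre_ultragraph \<Rightarrow> 'e list \<Rightarrow> 'v" where
  "path_src G \<alpha> = src G (hd \<alpha>)"

definition path_rng :: "('v, 'e) pre_ultragraph \<Rightarrow> 'e list \<Rightarrow> 'v set" where
  "path_rng G \<alpha> = rng G (last \<alpha>)"

definition minimal_infinite_emitter :: "('v, 'e) pre_ultragraph \<Rightarrow> 'v set \<Rightarrow> bool" where
  "minimal_infinite_emitter G A \<longleftrightarrow>
     A \<in> gen_verts G \<and> infinite (out_edges G A) \<and>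
     \<not> (\<exists>B \<in> gen_verts G. B \<subset> A \<and>
          (infinite (out_edges G B) \<or> infinite B \<and> finite (out_edges G B)))"

definition minimal_sink :: "('v, 'e) pre_ultragraph \<Rightarrow> 'v set \<Rightarrow> bool" where
  "minimal_sink G A \<longleftrightarrow>
     A \<in> gen_verts G \<and> infinite A \<and> finite (out_edges G A) \<and>
     \<not> (\<exists>B \<in> gen_verts G. B \<subset> A \<and> infinite B)"

definition terminal_boundary_sets :: "('v, 'e) pre_ultragraph \<Rightarrow> 'v set set" where
  "terminal_boundary_sets G =
     {A. minimal_infinite_emitter G A} \<union> {A. minimal_sink G A} \<union> {{v} | v. is_sink G v}"

definition is_cycle :: "('v, 'e) pre_ultragraph \<Rightarrow> 'e list \<Rightarrow> bool" where
  "is_cycle G c \<longleftrightarrow> is_path G c \<and> path_src G c \<in> path_rng G c \<and> distinct (map (src G) c)"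

definition lies_on_cycle :: "('v, 'e) pre_ultragraph \<Rightarrow> 'v \<Rightarrow> bool" where
  "lies_on_cycle G v \<longleftrightarrow> (\<exists>c. is_cycle G c \<and> v \<in> src G ` set c)"

definition has_exit :: "('v, 'e) pre_ultragraph \<Rightarrow> 'e list \<Rightarrow> bool" where
  "has_exit G c \<longleftrightarrow> (\<exists>i < length c.
     (\<exists>f \<in> edges G. src G f \<in> rng G (c ! i) \<and> f \<noteq> c ! (Suc i mod length c)) \<or>
     (\<exists>w \<in> rng G (c ! i). is_sink G w))"

definition no_infinite_receivers :: "('v, 'e) pre_ultragraph \<Rightarrow> bool" where
  "no_infinite_receivers G \<longleftrightarrow> (\<forall>v \<in> verts G. finite {e \<in> edges G. v \<in> rng G e})"

definition no_cycle_has_exit :: "('v, 'e) pre_ultragraph \<Rightarrow> bool" where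
  "no_cycle_has_exit G \<longleftrightarrow> (\<forall>c. is_cycle G c \<longrightarrow> \<not> has_exit G c)"

definition no_infinite_backward_chains :: "('v, 'e) pre_ultragraph \<Rightarrow> bool" where
  "no_infinite_backward_chains G \<longleftrightarrow>
     \<not> (\<exists>e :: nat \<Rightarrow> 'e. range e \<subseteq> edges G \<and> inj e \<and> (\<forall>i. src G (e i) \<in> rng G (e (Suc i))))"

definition reaches_terminal_boundary_set :: "('v, 'e) pre_ultragraph \<Rightarrow> 'v \<Rightarrow> bool" where
  "reaches_terminal_boundary_set G v \<longleftrightarrow>
     {v} \<in> terminal_boundary_sets G \<or>
     (\<exists>\<alpha>. \<exists>A \<in> terminal_boundary_sets G. is_path G \<alpha> \<and> path_src G \<alpha> = v \<and> A \<subseteq> path_rng G \<alpha>)"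

definition reaches_cycle :: "('v, 'e) pre_ultragraph \<Rightarrow> 'v \<Rightarrow> bool" where
  "reaches_cycle G v \<longleftrightarrow>
     lies_on_cycle G v \<or>
     (\<exists>\<alpha>. is_path G \<alpha> \<and> path_src G \<alpha> = v \<and> (\<exists>w \<in> path_rng G \<alpha>. lies_on_cycle G w))"

definition all_vertices_reach :: "('v, 'e) pre_ultragraph \<Rightarrow> bool" where
  "all_vertices_reach G \<longleftrightarrow>
     (\<forall>v \<in> verts G. reaches_terminal_boundary_set G v \<or> reaches_cycle G v)"


section \<open>Complex *-algebras\<close>

text \<open>Algebras are not required to have a unit: an ultragraph Leavitt path algebra is
  in general not unital.\<close>

record 'a star_algebra =
  alg_carrier :: "'a set"
  alg_zero :: 'a
  alg_add :: "'a \<Rightarrow> 'a \<Rightarrow> 'a"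
  alg_scale :: "complex \<Rightarrow> 'a \<Rightarrow> 'a"
  alg_mult :: "'a \<Rightarrow> 'a \<Rightarrow> 'a"
  alg_star :: "'a \<Rightarrow> 'a"

locale complex_star_algebra =
  fixes A :: "'a star_algebra"
  assumes zero_closed: "alg_zero A \<in> alg_carrier A"
    and add_closed: "\<lbrakk>x \<in> alg_carrier A; y \<in> alg_carrier A\<rbrakk> \<Longrightarrow> alg_add A x y \<in> alg_carrier A"
    and scale_closed: "x \<in> alg_carrier A \<Longrightarrow> alg_scale A c x \<in> alg_carrier A"
    and mult_closed: "\<lbrakk>x \<in> alg_carrier A; y \<in> alg_carrier A\<rbrakk> \<Longrightarrow> alg_mult A x y \<in> alg_carrier A"
    and star_closed: "x \<in> alg_carrier A \<Longrightarrow> alg_star A x \<in> alg_carrier A"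
    and add_assoc: "\<lbrakk>x \<in> alg_carrier A; y \<in> alg_carrier A; z \<in> alg_carrier A\<rbrakk> \<Longrightarrow>
          alg_add A (alg_add A x y) z = alg_add A x (alg_add A y z)"
    and add_commute: "\<lbrakk>x \<in> alg_carrier A; y \<in> alg_carrier A\<rbrakk> \<Longrightarrow> alg_add A x y = alg_add A y x"
    and add_zero: "x \<in> alg_carrier A \<Longrightarrow> alg_add A (alg_zero A) x = x"
    and add_neg: "x \<in> alg_carrier A \<Longrightarrow> alg_add A x (alg_scale A (- 1) x) = alg_zero A"
    and scale_one: "x \<in> alg_carrier A \<Longrightarrow> alg_scale A 1 x = x"
    and scale_scale: "x \<in> alg_carrier A \<Longrightarrow> alg_scale A c (alg_scale A d x) = alg_scale A (c * d) x"
    and scale_add_right: "\<lbrakk>x \<in> alg_carrier A; y \<in> alg_carrier A\<rbrakk> \<Longrightarrow>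
          alg_scale A c (alg_add A x y) = alg_add A (alg_scale A c x) (alg_scale A c y)"
    and scale_add_left: "x \<in> alg_carrier A \<Longrightarrow>
          alg_scale A (c + d) x = alg_add A (alg_scale A c x) (alg_scale A d x)"
    and mult_assoc: "\<lbrakk>x \<in> alg_carrier A; y \<in> alg_carrier A; z \<in> alg_carrier A\<rbrakk> \<Longrightarrow>
          alg_mult A (alg_mult A x y) z = alg_mult A x (alg_mult A y z)"
    and mult_add_left: "\<lbrakk>x \<in> alg_carrier A; y \<in> alg_carrier A; z \<in> alg_carrier A\<rbrakk> \<Longrightarrow>
          alg_mult A (alg_add A x y) z = alg_add A (alg_mult A x z) (alg_mult A y z)"
    and mult_add_right: "\<lbrakk>x \<in> alg_carrier A; y \<in> alg_carrier A; z \<in> alg_carrier A\<rbrakk> \<Longrightarrow>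
          alg_mult A x (alg_add A y z) = alg_add A (alg_mult A x y) (alg_mult A x z)"
    and mult_scale_left: "\<lbrakk>x \<in> alg_carrier A; y \<in> alg_carrier A\<rbrakk> \<Longrightarrow>
          alg_mult A (alg_scale A c x) y = alg_scale A c (alg_mult A x y)"
    and mult_scale_right: "\<lbrakk>x \<in> alg_carrier A; y \<in> alg_carrier A\<rbrakk> \<Longrightarrow>
          alg_mult A x (alg_scale A c y) = alg_scale A c (alg_mult A x y)"
    and star_star: "x \<in> alg_carrier A \<Longrightarrow> alg_star A (alg_star A x) = x"
    and star_add: "\<lbrakk>x \<in> alg_carrier A; y \<in> alg_carrier A\<rbrakk> \<Longrightarrow>
          alg_star A (alg_add A x y) = alg_add A (alg_star A x) (alg_star A y)"
    and star_scale: "x \<in> alg_carrier A \<Longrightarrow>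
          alg_star A (alg_scale A c x) = alg_scale A (cnj c) (alg_star A x)"
    and star_mult: "\<lbrakk>x \<in> alg_carrier A; y \<in> alg_carrier A\<rbrakk> \<Longrightarrow>
          alg_star A (alg_mult A x y) = alg_mult A (alg_star A y) (alg_star A x)"

definition star_hom :: "'a star_algebra \<Rightarrow> 'b star_algebra \<Rightarrow> ('a \<Rightarrow> 'b) set" where
  "star_hom A B = {\<pi>.
     (\<forall>x \<in> alg_carrier A. \<pi> x \<in> alg_carrier B) \<and>
     (\<forall>x \<in> alg_carrier A. \<forall>y \<in> alg_carrier A. \<pi> (alg_add A x y) = alg_add B (\<pi> x) (\<pi> y)) \<and>
     (\<forall>c. \<forall>x \<in> alg_carrier A. \<pi> (alg_scale A c x) = alg_scale B c (\<pi> x)) \<and>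
     (\<forall>x \<in> alg_carrier A. \<forall>y \<in> alg_carrier A. \<pi> (alg_mult A x y) = alg_mult B (\<pi> x) (\<pi> y)) \<and>
     (\<forall>x \<in> alg_carrier A. \<pi> (alg_star A x) = alg_star B (\<pi> x))}"

text \<open>The *-algebra of operators on the Hilbert space $\mathbb{C}^n$, given by matrices in the
  standard orthonormal basis; \<^const>\<open>mat_adjoint\<close> is the conjugate transpose. Up to unitary
  equivalence these are all the algebras $B(H)$ with $H$ a finite-dimensional Hilbert space.\<close>

definition operator_algebra :: "nat \<Rightarrow> complex mat star_algebra" where
  "operator_algebra n =
     \<lparr>alg_carrier = carrier_mat n n, alg_zero = 0\<^sub>m n n, alg_add = (+), alg_scale = (\<cdot>\<^sub>m),
      alg_mult = (*), alg_star = mat_adjoint\<rparr>"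

definition star_rfd :: "'a star_algebra \<Rightarrow> bool" where
  "star_rfd A \<longleftrightarrow> complex_star_algebra A \<and>
     (\<forall>a \<in> alg_carrier A. a \<noteq> alg_zero A \<longrightarrow>
        (\<exists>n. \<exists>\<pi> \<in> star_hom A (operator_algebra n). \<pi> a \<noteq> alg_zero (operator_algebra n)))"


section \<open>The free *-algebra on the generators\<close>

datatype ('v, 'e) generator = Edge 'e | Ghost 'e | Proj "'v set"

text \<open>Words are lists under concatenation, wrapped in a type of their own so that this
  monoid (written additively) can be the index monoid of \<^typ>\<open>'a \<Rightarrow>\<^sub>0 'b\<close>, whose product is then
  that of the free unital algebra.\<close>

datatype 'g gen_word = Word (letters: "'g list")

instantiation gen_word :: (type) monoid_add
begin

definition zero_gen_word :: "'a gen_word" where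
  "0 = Word []"

definition plus_gen_word :: "'a gen_word \<Rightarrow> 'a gen_word \<Rightarrow> 'a gen_word" where
  "u + w = Word (letters u @ letters w)"

instance
  by standard (simp_all add: zero_gen_word_def plus_gen_word_def)

end

definition generators :: "('v, 'e) pre_ultragraph \<Rightarrow> ('v, 'e) generator set" where
  "generators G = Edge ` edges G \<union> Ghost ` edges G \<union> Proj ` gen_verts G"

type_synonym ('v, 'e) free_elem = "('v, 'e) generator gen_word \<Rightarrow>\<^sub>0 complex"

text \<open>Only nonempty words occur, which makes this the free non-unital algebra.\<close>

definition free_carrier :: "('v, 'e) pre_ultragraph \<Rightarrow> ('v, 'e) free_elem set" where
  "free_carrier G = {f. \<forall>w \<in> Poly_Mapping.keys f. letters w \<noteq> [] \<and> set (letters w) \<subseteq> generators G}"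

definition free_scale :: "complex \<Rightarrow> ('v, 'e) free_elem \<Rightarrow> ('v, 'e) free_elem" where
  "free_scale c f = Poly_Mapping.map (\<lambda>z. c * z) f"

fun gen_star :: "('v, 'e) generator \<Rightarrow> ('v, 'e) generator" where
  "gen_star (Edge e) = Ghost e"
| "gen_star (Ghost e) = Edge e"
| "gen_star (Proj A) = Proj A"

definition word_star :: "('v, 'e) generator gen_word \<Rightarrow> ('v, 'e) generator gen_word" where
  "word_star w = Word (rev (map gen_star (letters w)))"

definition free_star :: "('v, 'e) free_elem \<Rightarrow> ('v, 'e) free_elem" where
  "free_star f = (\<Sum>w \<in> Poly_Mapping.keys f. Poly_Mapping.single (word_star w) (cnj (Poly_Mapping.lookup f w)))"

definition edge_gen :: "'e \<Rightarrow> ('v, 'e) free_elem" where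
  "edge_gen e = Poly_Mapping.single (Word [Edge e]) 1"

definition ghost_gen :: "'e \<Rightarrow> ('v, 'e) free_elem" where
  "ghost_gen e = Poly_Mapping.single (Word [Ghost e]) 1"

definition proj_gen :: "'v set \<Rightarrow> ('v, 'e) free_elem" where
  "proj_gen A = Poly_Mapping.single (Word [Proj A]) 1"


section \<open>The ultragraph Leavitt path algebra\<close>

text \<open>An element \<open>x - y\<close> of the following set stands for the defining relation \<open>x = y\<close>.\<close>

inductive_set lpa_relators :: "('v, 'e) pre_ultragraph \<Rightarrow> ('v, 'e) free_elem set"
  for G :: "('v, 'e) pre_ultragraph" where
  rel_empty: "proj_gen {} \<in> lpa_relators G"
| rel_Int: "\<lbrakk>A \<in> gen_verts G; B \<in> gen_verts G\<rbrakk> \<Longrightarrow>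
    proj_gen A * proj_gen B - proj_gen (A \<inter> B) \<in> lpa_relators G"
| rel_Un: "\<lbrakk>A \<in> gen_verts G; B \<in> gen_verts G\<rbrakk> \<Longrightarrow>
    proj_gen (A \<union> B) - (proj_gen A + proj_gen B - proj_gen (A \<inter> B)) \<in> lpa_relators G"
| rel_src_edge: "e \<in> edges G \<Longrightarrow>
    proj_gen {src G e} * edge_gen e - edge_gen e \<in> lpa_relators G"
| rel_edge_rng: "e \<in> edges G \<Longrightarrow>
    edge_gen e * proj_gen (rng G e) - edge_gen e \<in> lpa_relators G"
| rel_rng_ghost: "e \<in> edges G \<Longrightarrow>
    proj_gen (rng G e) * ghost_gen e - ghost_gen e \<in> lpa_relators G"
| rel_ghost_src: "e \<in> edges G \<Longrightarrow>
    ghost_gen e * proj_gen {src G e} - ghost_gen e \<in> lpa_relators G"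
| rel_ghost_edge: "\<lbrakk>e \<in> edges G; f \<in> edges G\<rbrakk> \<Longrightarrow>
    ghost_gen e * edge_gen f - (if e = f then proj_gen (rng G e) else 0) \<in> lpa_relators G"
| rel_regular: "is_regular G v \<Longrightarrow>
    proj_gen {v} - (\<Sum>e \<in> out_edges G {v}. edge_gen e * ghost_gen e) \<in> lpa_relators G"

inductive_set lpa_ideal :: "('v, 'e) pre_ultragraph \<Rightarrow> ('v, 'e) free_elem set"
  for G :: "('v, 'e) pre_ultragraph" where
  ideal_relator: "x \<in> lpa_relators G \<Longrightarrow> x \<in> lpa_ideal G"
| ideal_zero: "0 \<in> lpa_ideal G"
| ideal_add: "\<lbrakk>x \<in> lpa_ideal G; y \<in> lpa_ideal G\<rbrakk> \<Longrightarrow> x + y \<in> lpa_ideal G"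
| ideal_scale: "x \<in> lpa_ideal G \<Longrightarrow> free_scale c x \<in> lpa_ideal G"
| ideal_mult_left: "\<lbrakk>a \<in> free_carrier G; x \<in> lpa_ideal G\<rbrakk> \<Longrightarrow> a * x \<in> lpa_ideal G"
| ideal_mult_right: "\<lbrakk>x \<in> lpa_ideal G; a \<in> free_carrier G\<rbrakk> \<Longrightarrow> x * a \<in> lpa_ideal G"

definition lpa_class :: "('v, 'e) pre_ultragraph \<Rightarrow> ('v, 'e) free_elem \<Rightarrow> ('v, 'e) free_elem set" where
  "lpa_class G x = {y \<in> free_carrier G. y - x \<in> lpa_ideal G}"

text \<open>The operations on classes are defined through all representatives; the result is a single
  class since the ideal is invariant under \<^const>\<open>free_star\<close>.\<close>

definition leavitt_path_algebra ::
  "('v, 'e) pre_ultragraph \<Rightarrow> ('v, 'e) free_elem set star_algebra" where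
  "leavitt_path_algebra G =
     \<lparr>alg_carrier = lpa_class G ` free_carrier G,
      alg_zero = lpa_class G 0,
      alg_add = (\<lambda>X Y. \<Union>x \<in> X. \<Union>y \<in> Y. lpa_class G (x + y)),
      alg_scale = (\<lambda>c X. \<Union>x \<in> X. lpa_class G (free_scale c x)),
      alg_mult = (\<lambda>X Y. \<Union>x \<in> X. \<Union>y \<in> Y. lpa_class G (x * y)),
      alg_star = (\<lambda>X. \<Union>x \<in> X. lpa_class G (free_star x))\<rparr>"

end

theory Submission
  imports Defs
begin

text \<open>Let \<open>A\<close> be a terminal boundary set, or \<open>{v}\<close> with \<open>v\<close> on a cycle. The algebra acts on the space
  with basis the paths ending in \<open>A\<close>; as no cycle has an exit, Koenig's lemma with (B1) and (B3) makes
  this space finite-dimensional. By (B4) no vertex projection vanishes in all these representations.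
  Twisting them by the gauge action of the unit circle makes their common kernel \<open>K\<close> a graded ideal,
  and a graded ideal containing no vertex is zero. Indeed, elements of nonzero degree are moved to
  degree zero by multiplying with edges. If \<open>a\<close> in \<open>K\<close> has degree zero, then by induction on the length
  of the paths involved \<open>s\<^sub>e\<^sup>* a s\<^sub>f = 0\<close> for all edges, hence \<open>q a q = 0\<close> for a suitable finite sum \<open>q\<close> of
  projections \<open>s\<^sub>e s\<^sub>e\<^sup>*\<close>. This gives \<open>a = d (1 - q)\<close> with \<open>d\<close> a combination of set projections whose
  value at a vertex vanishes unless the vertex is regular with all its edges in \<open>q\<close>; so \<open>a = 0\<close>.\<close>

section \<open>Boundary paths\<close>

text \<open>One vertex with one loop shows why the gauge twist is indispensable: the algebra is that
  of Laurent polynomials, the empty list is the only boundary path, and the representation with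
  parameter z evaluates at z. No member of this family is faithful, but a Laurent polynomial that
  vanishes on the whole circle is zero. The obstacle on the algebraic side is that a set A in
  \<open>gen_verts G\<close> may be infinite or emit infinitely many edges, so
  \<open>p\<^sub>A\<close> need not be a finite sum of vertex projections or of projections
  \<open>s\<^sub>e s\<^sub>e\<^sup>*\<close>. Compressing to the corners
  \<open>s\<^sub>e\<^sup>* a s\<^sub>f\<close> therefore leaves a diagonal remainder. What controls
  it is that a combination of set projections is determined by its coefficient function on the
  vertices (\<open>diag_sum_eqv_zero\<close>), and that an ideal without vertex projections allows
  this function to be tested at one vertex at a time.\<close>

lemma is_path_iff_successively:
  "is_path G \<alpha> \<longleftrightarrow> \<alpha> \<noteq> [] \<and> set \<alpha> \<subseteq> edges G \<and> successively (\<lambda>e f. src G f \<in> rng G e) \<alpha>"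
  by (auto simp: is_path_def successively_conv_nth)

lemma is_path_Cons:
  "is_path G (e # \<alpha>) \<longleftrightarrow> e \<in> edges G \<and> (\<alpha> = [] \<or> src G (hd \<alpha>) \<in> rng G e \<and> is_path G \<alpha>)"
  by (auto simp: is_path_iff_successively successively_Cons)

lemma gen_verts_subset_verts:
  assumes "ultragraph G" "A \<in> gen_verts G"
  shows "A \<subseteq> verts G"
  using assms(2) by induction (use ultragraph.rng_subset_verts[OF assms(1)] in auto)

text \<open>Primeness is what the relation for \<open>p\<^bsub>B \<union> C\<^esub>\<close> requires of a representation on the paths ending
  in \<open>A\<close>, and the last condition is what the relation at regular vertices requires.\<close>

definition prime_boundary :: "('v, 'e) pre_ultragraph \<Rightarrow> 'v set \<Rightarrow> bool" where
  "prime_boundary G A \<longleftrightarrow> A \<noteq> {} \<and>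
     (\<forall>B \<in> gen_verts G. \<forall>C \<in> gen_verts G. A \<subseteq> B \<union> C \<longrightarrow> A \<subseteq> B \<or> A \<subseteq> C) \<and>
     (\<forall>v. A = {v} \<and> is_regular G v \<longrightarrow> lies_on_cycle G v)"

text \<open>The empty list stands for \<open>A\<close> itself. If \<open>A = {v}\<close> with \<open>v\<close> on a cycle, then paths are cut
  off at their first visit to \<open>v\<close>: a path \<open>\<alpha>\<close> represents the infinite path that follows \<open>\<alpha>\<close>
  and then runs around the cycle forever.\<close>

definition boundary_paths :: "('v, 'e) pre_ultragraph \<Rightarrow> 'v set \<Rightarrow> 'e list set" where
  "boundary_paths G A =
     {\<alpha>. \<alpha> = [] \<or> is_path G \<alpha> \<and> A \<subseteq> path_rng G \<alpha> \<and> (\<forall>e \<in> set \<alpha>. {src G e} \<noteq> A)}"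

text \<open>This decides both whether \<open>p\<^sub>B\<close> fixes the basis vector \<alpha> and
  whether an edge with range B may be put in front of \<alpha>. The empty list is the boundary A,
  which counts as a point of every set that contains A.\<close>

definition begins_in :: "('v, 'e) pre_ultragraph \<Rightarrow> 'v set \<Rightarrow> 'v set \<Rightarrow> 'e list \<Rightarrow> bool" where
  "begins_in G A B \<alpha> \<longleftrightarrow> (if \<alpha> = [] then A \<subseteq> B else path_src G \<alpha> \<in> B)"

text \<open>An edge that starts at the boundary vertex itself completes a turn around the cycle; the
  infinite path so obtained is represented by the empty list.\<close>

definition prepend :: "('v, 'e) pre_ultragraph \<Rightarrow> 'v set \<Rightarrow> 'e \<Rightarrow> 'e list \<Rightarrow> 'e list" where
  "prepend G A e \<alpha> = (if {src G e} = A then [] else e # \<alpha>)"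

lemma begins_in_simps [simp]:
  "begins_in G A B [] \<longleftrightarrow> A \<subseteq> B"
  "begins_in G A B (e # \<alpha>) \<longleftrightarrow> src G e \<in> B"
  by (simp_all add: begins_in_def path_src_def)

lemma Nil_in_boundary_paths [simp]: "[] \<in> boundary_paths G A"
  by (simp add: boundary_paths_def)

lemma Cons_in_boundary_paths:
  "e # \<alpha> \<in> boundary_paths G A \<longleftrightarrow>
     e \<in> edges G \<and> {src G e} \<noteq> A \<and> \<alpha> \<in> boundary_paths G A \<and> begins_in G A (rng G e) \<alpha>"
  by (cases \<alpha>) (auto simp: boundary_paths_def is_path_Cons path_rng_def)

lemma prepend_in_boundary_paths:
  "e \<in> edges G \<Longrightarrow> \<alpha> \<in> boundary_paths G A \<Longrightarrow> begins_in G A (rng G e) \<alpha> \<Longrightarrow>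
     prepend G A e \<alpha> \<in> boundary_paths G A"
  by (auto simp: prepend_def Cons_in_boundary_paths)

lemma begins_in_prepend: "begins_in G A {src G e} (prepend G A e \<alpha>)"
  by (auto simp: prepend_def)

lemma begins_in_mono: "B \<subseteq> C \<Longrightarrow> begins_in G A B \<alpha> \<Longrightarrow> begins_in G A C \<alpha>"
  by (auto simp: begins_in_def split: if_splits)

lemma begins_in_empty: "A \<noteq> {} \<Longrightarrow> \<not> begins_in G A {} \<alpha>"
  by (simp add: begins_in_def)

lemma begins_in_Int: "begins_in G A (B \<inter> C) \<alpha> \<longleftrightarrow> begins_in G A B \<alpha> \<and> begins_in G A C \<alpha>"
  by (auto simp: begins_in_def)

lemma begins_in_Un:
  assumes "prime_boundary G A" "B \<in> gen_verts G" "C \<in> gen_verts G"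
  shows "begins_in G A (B \<union> C) \<alpha> \<longleftrightarrow> begins_in G A B \<alpha> \<or> begins_in G A C \<alpha>"
proof (cases \<alpha>)
  case Nil
  have "A \<subseteq> B \<union> C \<longrightarrow> A \<subseteq> B \<or> A \<subseteq> C"
    using assms by (auto simp: prime_boundary_def)
  then show ?thesis using Nil by auto
qed simp

section \<open>Rigidity of cycles without exits, and finiteness of the basis\<close>

locale rfd_ultragraph = ultragraph +
  assumes no_infinite_receivers: "no_infinite_receivers G"
    and no_cycle_has_exit: "no_cycle_has_exit G"
    and no_infinite_backward_chains: "no_infinite_backward_chains G"
    and all_vertices_reach: "all_vertices_reach G"
begin

text \<open>Without exits, e can be followed only by its successor on the cycle. A vertex in the
  range of e is no sink, so it emits an edge, which must be this successor; hence the range is a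
  single vertex.\<close>

lemma cycle_next:
  assumes c: "is_cycle G c" and e: "e \<in> set c"
  shows "\<exists>e' \<in> set c. rng G e = {src G e'} \<and> (\<forall>f \<in> edges G. src G f = src G e' \<longrightarrow> f = e')"
proof -
  have ce: "set c \<subseteq> edges G" "c \<noteq> []" using c by (auto simp: is_cycle_def is_path_def)
  obtain i where i: "i < length c" "c ! i = e" using e by (auto simp: in_set_conv_nth)
  let ?e' = "c ! (Suc i mod length c)"
  have e': "?e' \<in> set c" using ce by simp
  have nex: "\<not> has_exit G c" using no_cycle_has_exit c by (simp add: no_cycle_has_exit_def)
  have 1: "f = ?e'" if "f \<in> edges G" "src G f \<in> rng G e" for f
    using nex that i by (auto simp: has_exit_def)
  have 2: "w = src G ?e'" if w: "w \<in> rng G e" for w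
  proof -
    have "\<not> is_sink G w" using nex w i by (auto simp: has_exit_def)
    moreover have "w \<in> verts G" using rng_subset_verts ce e w by blast
    ultimately obtain f where "f \<in> edges G" "src G f = w"
      by (auto simp: is_sink_def out_edges_def)
    then show ?thesis using 1[of f] w by auto
  qed
  have "rng G e = {src G ?e'}" using 2 rng_nonempty[of e] ce e by blast
  then show ?thesis using 1 e' by auto
qed

text \<open>By \<open>cycle_next\<close> each further edge of the path is forced to be the next edge
  of the cycle.\<close>

lemma cycle_path_stays:
  assumes c: "is_cycle G c"
  shows "is_path G (e # \<alpha>) \<Longrightarrow> e \<in> set c \<Longrightarrow> \<exists>e' \<in> set c. rng G (last (e # \<alpha>)) = {src G e'}"
proof (induction \<alpha> arbitrary: e)
  case Nil
  then show ?case using cycle_next[OF c, of e] by auto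
next
  case (Cons f \<alpha>)
  obtain e' where e': "e' \<in> set c" "rng G e = {src G e'}" "\<forall>f \<in> edges G. src G f = src G e' \<longrightarrow> f = e'"
    using cycle_next[OF c Cons.prems(2)] by blast
  have "f \<in> edges G" "src G f \<in> rng G e" "is_path G (f # \<alpha>)"
    using Cons.prems(1) by (auto simp: is_path_Cons)
  then have "f \<in> set c" using e' by auto
  then show ?case using Cons.IH[OF \<open>is_path G (f # \<alpha>)\<close>] by simp
qed

text \<open>An edge f different from e with the source of e would be an exit at the predecessor of e
  on the cycle.\<close>

lemma cycle_src_unique:
  assumes c: "is_cycle G c" and e: "e \<in> set c" and f: "f \<in> edges G" "src G f = src G e"
  shows "f = e"
proof -
  obtain i where i: "i < length c" "c ! i = e" using e by (auto simp: in_set_conv_nth)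
  \<comment> \<open>The index of the predecessor; it wraps around to the last edge when e is the
    first.\<close>
  have ex: "\<exists>j < length c. Suc j mod length c = i"
  proof (cases i)
    case 0
    then show ?thesis using i by (intro exI[of _ "length c - 1"]) auto
  next
    case (Suc j)
    then show ?thesis using i by (intro exI[of _ j]) auto
  qed
  then obtain j where j: "j < length c" "Suc j mod length c = i" by blast
  have nex: "\<not> has_exit G c" using no_cycle_has_exit c by (simp add: no_cycle_has_exit_def)
  have "src G (c ! i) \<in> rng G (c ! j)"
  proof (cases "Suc j < length c")
    case True
    then show ?thesis using c j by (auto simp: is_cycle_def is_path_def)
  next
    case False
    then have "Suc j = length c" using j by simp
    then have "i = 0" "j = length c - 1" using j by auto
    then show ?thesis using c by (auto simp: is_cycle_def path_src_def path_rng_def is_path_def hd_conv_nth last_conv_nth)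
  qed
  then have "src G f \<in> rng G (c ! j)" using f i by simp
  then have "f = c ! (Suc j mod length c)" using nex j(1) f(1) unfolding has_exit_def by blast
  then show ?thesis using i j by simp
qed

text \<open>A repeated source closes a cycle, which the path can never leave. Then A, being
  contained in the last range, is the source vertex of an edge on this cycle; the path uses that
  edge, although it should have been cut off there.\<close>

lemma boundary_paths_distinct:
  assumes "A \<noteq> {}"
  shows "\<alpha> \<in> boundary_paths G A \<Longrightarrow> distinct (map (src G) \<alpha>)"
proof (induction \<alpha>)
  case (Cons e \<alpha>)
  have \<alpha>: "\<alpha> \<in> boundary_paths G A" using Cons.prems by (simp add: Cons_in_boundary_paths)
  have "src G e \<notin> src G ` set \<alpha>"
  proof
    assume "src G e \<in> src G ` set \<alpha>"
    then obtain f \<mu> \<rho> where f: "src G f = src G e" "\<alpha> = \<mu> @ f # \<rho>"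
      by (metis imageE split_list)
    have p: "is_path G (e # \<mu> @ f # \<rho>)" "A \<subseteq> rng G (last (f # \<rho>))"
      using Cons.prems f by (auto simp: boundary_paths_def path_rng_def)
    \<comment> \<open>The sources along \<alpha> are distinct, so the source of e, which is that of
      f, does not recur in \<mu>.\<close>
    have cyc: "is_cycle G (e # \<mu>)"
      using p(1) f Cons.IH[OF \<alpha>]
      by (auto simp: is_cycle_def is_path_iff_successively path_src_def path_rng_def
          successively_append_iff successively_Cons hd_append split: if_splits)
    have "f \<in> edges G" using p(1) by (auto simp: is_path_def)
    then have "f = e" using cycle_src_unique[OF cyc, of e f] f by simp
    moreover have "is_path G (f # \<rho>)"
      using p(1) by (auto simp: is_path_iff_successively successively_append_iff successively_Cons)
    ultimately obtain e' where e': "e' \<in> set (e # \<mu>)" "rng G (last (f # \<rho>)) = {src G e'}"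
      using cycle_path_stays[OF cyc, of f \<rho>] by auto
    then have "A = {src G e'}" using p(2) assms by (simp add: subset_singleton_iff)
    moreover have "e' \<in> set (e # \<alpha>)" using e' f by auto
    ultimately show False using Cons.prems by (auto simp: boundary_paths_def)
  qed
  then show ?case using Cons.IH[OF \<alpha>] by simp
qed simp

text \<open>Koenig's lemma: the tree of boundary paths is finitely branching by the absence of infinite
  receivers, and an infinite branch would be an infinite backward chain.\<close>

lemma finite_boundary_paths:
  assumes A: "A \<noteq> {}" "A \<subseteq> verts G"
  shows "finite (boundary_paths G A)"
proof -
  let ?T = "boundary_paths G A"
  define R where "R = {(e # \<alpha>, \<alpha>) | e \<alpha>. e # \<alpha> \<in> ?T}"
  have "wf R"
    unfolding wf_iff_no_infinite_down_chain
  proof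
    assume "\<exists>h. \<forall>i. (h (Suc i), h i) \<in> R"
    then obtain h where h: "\<And>i. (h (Suc i), h i) \<in> R" by blast
    define x where "x i = hd (h (Suc i))" for i
    have hS: "h (Suc i) = x i # h i" "h (Suc i) \<in> ?T" for i
      using h[of i] unfolding R_def x_def by force+
    have mem: "x i \<in> set (h (Suc (i + k)))" for i k
    proof (induction k)
      case 0
      show ?case using hS(1)[of i] by simp
    next
      case (Suc k)
      then show ?case using hS(1)[of "Suc (i + k)"] by simp
    qed
    have "x i \<noteq> x j" if ij: "i < j" for i j
    proof -
      obtain k where k: "j = Suc (i + k)" using less_imp_Suc_add[OF ij] by blast
      have "x i \<in> set (h j)" unfolding k by (rule mem)
      moreover have "distinct (map (src G) (x j # h j))"
        using boundary_paths_distinct[OF A(1) hS(2)[of j]] hS(1)[of j] by simp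
      ultimately show ?thesis by force
    qed
    then have "inj x" by (rule linorder_injI)
    moreover have "range x \<subseteq> edges G"
      using hS by (auto simp: Cons_in_boundary_paths)
    moreover have "src G (x i) \<in> rng G (x (Suc i))" for i
      using hS(2)[of "Suc i"] hS(1) by (simp add: Cons_in_boundary_paths)
    ultimately show False
      using no_infinite_backward_chains unfolding no_infinite_backward_chains_def by blast
  qed
  have fin: "finite {e. e # \<alpha> \<in> ?T}" if "\<alpha> \<in> ?T" for \<alpha>
  proof -
    \<comment> \<open>All edges that may precede \<alpha> have a common vertex in their ranges: any
      vertex of A if \<alpha> is empty, otherwise the source of its first edge.\<close>
    have "\<exists>v \<in> verts G. {e. e # \<alpha> \<in> ?T} \<subseteq> {e \<in> edges G. v \<in> rng G e}"
    proof (cases \<alpha>)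
      case Nil
      obtain v where "v \<in> A" using A by blast
      then show ?thesis using Nil A by (auto simp: Cons_in_boundary_paths)
    next
      case (Cons f \<beta>)
      then have "f \<in> edges G" using that by (simp add: Cons_in_boundary_paths)
      then show ?thesis using Cons src_in_verts by (auto simp: Cons_in_boundary_paths)
    qed
    then obtain v where v: "v \<in> verts G" "{e. e # \<alpha> \<in> ?T} \<subseteq> {e \<in> edges G. v \<in> rng G e}" by blast
    have "finite {e \<in> edges G. v \<in> rng G e}"
      using no_infinite_receivers v(1) by (simp add: no_infinite_receivers_def)
    with v(2) show ?thesis by (rule finite_subset)
  qed
  have "\<alpha> \<in> ?T \<Longrightarrow> finite {\<beta> \<in> ?T. \<exists>\<gamma>. \<beta> = \<gamma> @ \<alpha>}" for \<alpha>
    using \<open>wf R\<close>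
  proof (induction \<alpha> rule: wf_induct_rule)
    case (less \<alpha>)
    have "{\<beta> \<in> ?T. \<exists>\<gamma>. \<beta> = \<gamma> @ \<alpha>} \<subseteq>
        insert \<alpha> (\<Union>e \<in> {e. e # \<alpha> \<in> ?T}. {\<beta> \<in> ?T. \<exists>\<gamma>. \<beta> = \<gamma> @ e # \<alpha>})"
    proof
      fix \<beta> assume "\<beta> \<in> {\<beta> \<in> ?T. \<exists>\<gamma>. \<beta> = \<gamma> @ \<alpha>}"
      then obtain \<gamma> where g: "\<gamma> @ \<alpha> \<in> ?T" "\<beta> = \<gamma> @ \<alpha>" by blast
      show "\<beta> \<in> insert \<alpha> (\<Union>e \<in> {e. e # \<alpha> \<in> ?T}. {\<beta> \<in> ?T. \<exists>\<gamma>. \<beta> = \<gamma> @ e # \<alpha>})"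
      proof (cases "\<gamma> = []")
        case True
        then show ?thesis using g by simp
      next
        case False
        then obtain \<delta> e where d: "\<gamma> = \<delta> @ [e]" by (metis rev_exhaust)
        have "\<delta>' @ \<alpha>' \<in> ?T \<Longrightarrow> \<alpha>' \<in> ?T" for \<delta>' \<alpha>'
          by (induction \<delta>') (auto simp: Cons_in_boundary_paths)
        from this[of \<delta> "e # \<alpha>"] have "e # \<alpha> \<in> ?T" using g d by simp
        then show ?thesis using g d by auto
      qed
    qed
    moreover have "finite {\<beta> \<in> ?T. \<exists>\<gamma>. \<beta> = \<gamma> @ e # \<alpha>}" if "e # \<alpha> \<in> ?T" for e
      using less.IH[of "e # \<alpha>"] that by (auto simp: R_def)
    moreover have "finite {e. e # \<alpha> \<in> ?T}" using fin[OF less.prems] .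
    ultimately show ?case by (auto elim!: finite_subset intro!: finite_UN_I)
  qed
  from this[of "[]"] show ?thesis by simp
qed

text \<open>Both paths are forced to run along the cycle. They also stop together: if one stops at
  v, the other cannot continue, as its next edge would start at v.\<close>

lemma cycle_boundary_path_unique:
  assumes c: "is_cycle G c"
  shows "\<alpha> \<in> boundary_paths G {v} \<Longrightarrow> \<beta> \<in> boundary_paths G {v} \<Longrightarrow> e \<in> set c \<Longrightarrow>
    begins_in G {v} (rng G e) \<alpha> \<Longrightarrow> begins_in G {v} (rng G e) \<beta> \<Longrightarrow> \<alpha> = \<beta>"
proof (induction \<alpha> arbitrary: e \<beta>)
  case Nil
  obtain e' where "rng G e = {src G e'}" using cycle_next[OF c Nil.prems(3)] by blast
  then show ?case using Nil.prems by (cases \<beta>) (auto simp: Cons_in_boundary_paths)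
next
  case (Cons f \<alpha>)
  obtain e' where e': "e' \<in> set c" "rng G e = {src G e'}" "\<forall>f \<in> edges G. src G f = src G e' \<longrightarrow> f = e'"
    using cycle_next[OF c Cons.prems(3)] by blast
  obtain g \<beta>' where \<beta>: "\<beta> = g # \<beta>'"
    using Cons.prems e' by (cases \<beta>) (auto simp: Cons_in_boundary_paths)
  have "f = e'" "g = e'" using Cons.prems e' \<beta> by (auto simp: Cons_in_boundary_paths)
  then show ?case using Cons.IH[of \<beta>' e'] Cons.prems \<beta> e' by (auto simp: Cons_in_boundary_paths)
qed

text \<open>Hence \<open>prepend\<close> cuts off only on cycles, where the exit condition
  applies.\<close>

lemma return_path_is_cycle:
  assumes "e \<in> edges G" "\<alpha> \<in> boundary_paths G {src G e}" "begins_in G {src G e} (rng G e) \<alpha>"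
  shows "is_cycle G (e # \<alpha>)"
proof -
  have d: "distinct (map (src G) \<alpha>)" using boundary_paths_distinct assms(2) by blast
  have "src G e \<notin> src G ` set \<alpha>" using assms(2) by (auto simp: boundary_paths_def)
  then show ?thesis using assms d
    by (cases \<alpha>) (auto simp: is_cycle_def is_path_Cons boundary_paths_def path_src_def path_rng_def)
qed

text \<open>If nothing is cut off, \<open>prepend\<close> is Cons. Otherwise e and \<alpha> form a
  cycle through the source of e, so the edge with this source is unique and so is the boundary path
  that follows it. This gives the relation for \<open>s\<^sub>e\<^sup>* s\<^sub>f\<close>.\<close>

lemma prepend_inj:
  assumes "e \<in> edges G" "f \<in> edges G" "\<alpha> \<in> boundary_paths G A" "\<beta> \<in> boundary_paths G A"
    and "begins_in G A (rng G e) \<alpha>" "begins_in G A (rng G f) \<beta>"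
    and eq: "prepend G A e \<alpha> = prepend G A f \<beta>"
  shows "e = f \<and> \<alpha> = \<beta>"
proof (cases "{src G e} = A")
  case True
  then have f: "src G f = src G e" using eq by (auto simp: prepend_def split: if_splits)
  have cyc: "is_cycle G (e # \<alpha>)" using return_path_is_cycle assms True by auto
  have "f = e" using cycle_src_unique[OF cyc] assms f by simp
  then show ?thesis
    using cycle_boundary_path_unique[OF cyc, of \<alpha> "src G e" \<beta> e] assms True by auto
next
  case False
  then show ?thesis using eq by (auto simp: prepend_def split: if_splits)
qed

text \<open>The counterpart of injectivity that the relation at regular vertices needs. Only the
  empty path is critical: then v is the boundary and lies on a cycle, and one full turn provides the
  preimage.\<close>

lemma regular_prepend:
  assumes A: "prime_boundary G A" and v: "is_regular G v"
    and \<alpha>: "\<alpha> \<in> boundary_paths G A" "begins_in G A {v} \<alpha>"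
  shows "\<exists>e \<beta>. e \<in> edges G \<and> src G e = v \<and> \<beta> \<in> boundary_paths G A \<and>
    begins_in G A (rng G e) \<beta> \<and> \<alpha> = prepend G A e \<beta>"
proof (cases \<alpha>)
  case (Cons e \<beta>)
  then show ?thesis using \<alpha> by (intro exI[of _ e] exI[of _ \<beta>]) (auto simp: Cons_in_boundary_paths prepend_def)
next
  case Nil
  have Av: "A = {v}" using \<alpha> Nil A by (auto simp: prime_boundary_def)
  then have "lies_on_cycle G v" using A v by (auto simp: prime_boundary_def)
  then obtain c e where c: "is_cycle G c" "e \<in> set c" "src G e = v" by (auto simp: lies_on_cycle_def)
  then obtain \<mu> \<rho> where cs: "c = \<mu> @ e # \<rho>" by (metis split_list)
  have e: "e \<in> edges G" using c by (auto simp: is_cycle_def is_path_def)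
  \<comment> \<open>The cycle is rotated to start with e. What follows e is a boundary path because
    no edge of it starts at v.\<close>
  have "is_path G (e # \<rho> @ \<mu>)" "v \<in> path_rng G (e # \<rho> @ \<mu>)"
    using c cs by (auto simp: is_cycle_def is_path_iff_successively successively_append_iff
        successively_Cons path_src_def path_rng_def hd_append split: if_splits)
  moreover have "\<forall>f \<in> set (\<rho> @ \<mu>). src G f \<noteq> v" using c cs by (auto simp: is_cycle_def) (metis imageI)+
  ultimately have "\<rho> @ \<mu> \<in> boundary_paths G A" "begins_in G A (rng G e) (\<rho> @ \<mu>)"
    unfolding Av begins_in_def
    by (auto simp: boundary_paths_def is_path_Cons path_rng_def path_src_def split: if_splits)
  then show ?thesis
    using e c Av Nil by (intro exI[of _ e] exI[of _ "\<rho> @ \<mu>"]) (auto simp: prepend_def)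
qed

section \<open>Terminal boundary sets and cycle vertices as boundaries\<close>

lemma infinite_out_edges_Un:
  assumes "A = B \<union> C" "infinite (out_edges G A)"
  shows "infinite (out_edges G B) \<or> infinite (out_edges G C)"
proof -
  have "out_edges G A = out_edges G B \<union> out_edges G C" using assms(1) by (auto simp: out_edges_def)
  then show ?thesis using assms(2) by simp
qed

text \<open>If B and C cover A, then one of the intersections with A inherits its infinite emission
  or its infinite size; by minimality this intersection is all of A.\<close>

lemma prime_boundary_terminal:
  assumes "A \<in> terminal_boundary_sets G"
  shows "prime_boundary G A \<and> A \<subseteq> verts G"
proof -
  consider "minimal_infinite_emitter G A" | "minimal_sink G A" | v where "is_sink G v" "A = {v}"
    using assms by (auto simp: terminal_boundary_sets_def)
  then show ?thesis
  proof cases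
    case 1
    have A: "A \<in> gen_verts G" "infinite (out_edges G A)" using 1 by (auto simp: minimal_infinite_emitter_def)
    have "A \<subseteq> B \<or> A \<subseteq> C" if BC: "B \<in> gen_verts G" "C \<in> gen_verts G" "A \<subseteq> B \<union> C" for B C
    proof -
      have "A = (A \<inter> B) \<union> (A \<inter> C)" using BC by auto
      then have "infinite (out_edges G (A \<inter> B)) \<or> infinite (out_edges G (A \<inter> C))"
        using infinite_out_edges_Un A by blast
      moreover have "A \<inter> B \<in> gen_verts G" "A \<inter> C \<in> gen_verts G" using A BC by (auto intro: gen_Int)
      ultimately have "\<not> A \<inter> B \<subset> A \<or> \<not> A \<inter> C \<subset> A" using 1 by (auto simp: minimal_infinite_emitter_def)
      then show ?thesis by auto
    qed
    moreover have "A \<noteq> {}" using A by (auto simp: out_edges_def)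
    ultimately show ?thesis using A gen_verts_subset_verts[OF ultragraph_axioms]
      by (auto simp: prime_boundary_def is_regular_def)
  next
    case 2
    have A: "A \<in> gen_verts G" "infinite A" using 2 by (auto simp: minimal_sink_def)
    have "A \<subseteq> B \<or> A \<subseteq> C" if BC: "B \<in> gen_verts G" "C \<in> gen_verts G" "A \<subseteq> B \<union> C" for B C
    proof -
      have "A = (A \<inter> B) \<union> (A \<inter> C)" using BC by auto
      then have "infinite (A \<inter> B) \<or> infinite (A \<inter> C)" using A by (metis finite_UnI)
      moreover have "A \<inter> B \<in> gen_verts G" "A \<inter> C \<in> gen_verts G" using A BC by (auto intro: gen_Int)
      ultimately have "\<not> A \<inter> B \<subset> A \<or> \<not> A \<inter> C \<subset> A" using 2 by (auto simp: minimal_sink_def)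
      then show ?thesis by auto
    qed
    then show ?thesis using A gen_verts_subset_verts[OF ultragraph_axioms]
      by (auto simp: prime_boundary_def)
  next
    case 3
    then show ?thesis by (auto simp: prime_boundary_def is_sink_def is_regular_def)
  qed
qed

lemma prime_boundary_cycle:
  assumes "lies_on_cycle G v"
  shows "prime_boundary G {v} \<and> {v} \<subseteq> verts G"
proof -
  have "v \<in> verts G" using assms src_in_verts by (auto simp: lies_on_cycle_def is_cycle_def is_path_def)
  then show ?thesis using assms by (auto simp: prime_boundary_def)
qed

text \<open>A path whose range contains A need not be a boundary path, since it may already have
  passed through the vertex of a singleton A; it is cut off at the first such visit.\<close>

lemma vertex_reaches_boundary:
  assumes v: "v \<in> verts G"
  shows "\<exists>A \<alpha>. prime_boundary G A \<and> A \<subseteq> verts G \<and> \<alpha> \<in> boundary_paths G A \<and> begins_in G A {v} \<alpha>"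
proof -
  have "(\<exists>A. prime_boundary G A \<and> A \<subseteq> verts G \<and> (A = {v} \<or>
      (\<exists>\<alpha>. is_path G \<alpha> \<and> path_src G \<alpha> = v \<and> A \<subseteq> path_rng G \<alpha>)))"
    using all_vertices_reach v prime_boundary_terminal prime_boundary_cycle
    unfolding all_vertices_reach_def reaches_terminal_boundary_set_def reaches_cycle_def
    by (metis empty_subsetI insert_subset)
  then obtain A where A: "prime_boundary G A" "A \<subseteq> verts G"
    and "A = {v} \<or> (\<exists>\<alpha>. is_path G \<alpha> \<and> path_src G \<alpha> = v \<and> A \<subseteq> path_rng G \<alpha>)" by blast
  moreover have "\<exists>\<beta> \<in> boundary_paths G A. begins_in G A {path_src G \<alpha>} \<beta>"
    if "is_path G \<alpha>" "A \<subseteq> path_rng G \<alpha>" for \<alpha>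
    using that
  proof (induction \<alpha>)
    case Nil
    then show ?case by (simp add: is_path_def)
  next
    case (Cons e \<alpha>)
    show ?case
    proof (cases "{src G e} = A")
      case True
      then show ?thesis by (intro bexI[of _ "[]"]) (auto simp: path_src_def)
    next
      case ne: False
      have e: "e \<in> edges G" using Cons.prems by (simp add: is_path_Cons)
      have "\<exists>\<beta> \<in> boundary_paths G A. begins_in G A (rng G e) \<beta>"
      proof (cases "\<alpha> = []")
        case True
        then show ?thesis using Cons.prems by (intro bexI[of _ "[]"]) (auto simp: path_rng_def)
      next
        case False
        then have "\<exists>\<beta> \<in> boundary_paths G A. begins_in G A {path_src G \<alpha>} \<beta>"
          using Cons by (simp add: is_path_Cons path_rng_def)
        moreover have "path_src G \<alpha> \<in> rng G e" using Cons.prems False by (simp add: is_path_Cons path_src_def)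
        ultimately show ?thesis using begins_in_mono[of "{path_src G \<alpha>}" "rng G e"] by auto
      qed
      then obtain \<beta> where "\<beta> \<in> boundary_paths G A" "begins_in G A (rng G e) \<beta>" by blast
      then have "e # \<beta> \<in> boundary_paths G A" using e ne by (simp add: Cons_in_boundary_paths)
      then show ?thesis by (intro bexI[of _ "e # \<beta>"]) (auto simp: path_src_def)
    qed
  qed
  ultimately show ?thesis by (metis Nil_in_boundary_paths begins_in_simps(1) subset_refl)
qed

end

section \<open>The free algebra\<close>

lemma poly_mapping_sum_single:
  fixes x :: "'a \<Rightarrow>\<^sub>0 'b::comm_monoid_add"
  shows "x = (\<Sum>w \<in> Poly_Mapping.keys x. Poly_Mapping.single w (Poly_Mapping.lookup x w))"
proof (rule poly_mapping_eqI)
  fix v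
  show "Poly_Mapping.lookup x v = Poly_Mapping.lookup (\<Sum>w \<in> Poly_Mapping.keys x.
      Poly_Mapping.single w (Poly_Mapping.lookup x w)) v"
    by (simp add: lookup_sum lookup_single when_def in_keys_iff)
qed

text \<open>The added word stays in the support of x, so that the induction step can use what is
  known about this support.\<close>

lemma poly_mapping_single_induct [case_names zero single]:
  fixes x :: "'a \<Rightarrow>\<^sub>0 'b::comm_monoid_add"
  assumes zero: "P 0" and single: "\<And>y w c. w \<in> Poly_Mapping.keys x \<Longrightarrow> P y \<Longrightarrow> P (y + Poly_Mapping.single w c)"
  shows "P x"
proof -
  have "S \<subseteq> Poly_Mapping.keys x \<Longrightarrow> P (\<Sum>w\<in>S. Poly_Mapping.single w (Poly_Mapping.lookup x w))"
    if "finite S" for S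
    using that
  proof induction
    case (insert w S)
    then show ?case
      using single[of w "\<Sum>w\<in>S. Poly_Mapping.single w (Poly_Mapping.lookup x w)"]
      by (simp add: add.commute)
  qed (simp add: zero)
  from this[OF finite_keys order_refl] show ?thesis
    by (simp only: poly_mapping_sum_single[symmetric])
qed

text \<open>Reduces identities such as the multiplicativity of a representation to single
  words.\<close>

lemma additive_eqI:
  fixes f g :: "('a \<Rightarrow>\<^sub>0 'b::comm_monoid_add) \<Rightarrow> 'c::ab_group_add"
  assumes "\<And>x y. f (x + y) = f x + f y" "\<And>x y. g (x + y) = g x + g y"
    and "\<And>w c. f (Poly_Mapping.single w c) = g (Poly_Mapping.single w c)"
  shows "f x = g x"
proof (induction x rule: poly_mapping_single_induct)
  case zero
  have "f 0 = 0" "g 0 = 0" using assms(1)[of 0 0] assms(2)[of 0 0] by simp_all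
  then show ?case by simp
qed (simp add: assms)

lemma biadditive_eqI:
  fixes f g :: "('a \<Rightarrow>\<^sub>0 'b::comm_monoid_add) \<Rightarrow> ('a \<Rightarrow>\<^sub>0 'b) \<Rightarrow> 'c::ab_group_add"
  assumes "\<And>x x' y. f (x + x') y = f x y + f x' y" "\<And>x x' y. g (x + x') y = g x y + g x' y"
    and "\<And>x y y'. f x (y + y') = f x y + f x y'" "\<And>x y y'. g x (y + y') = g x y + g x y'"
    and "\<And>u v a b. f (Poly_Mapping.single u a) (Poly_Mapping.single v b) =
      g (Poly_Mapping.single u a) (Poly_Mapping.single v b)"
  shows "f x y = g x y"
proof -
  have "f (Poly_Mapping.single u a) y = g (Poly_Mapping.single u a) y" for u a
    by (rule additive_eqI) (rule assms)+
  then show ?thesis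
    by (rule additive_eqI[of "\<lambda>x. f x y" "\<lambda>x. g x y", OF assms(1,2)])
qed

text \<open>Additive extension of a map given on single terms. Only additivity in the coefficient is
  asked of h, so conjugate-linear maps such as \<open>free_star\<close> are covered as well.\<close>

definition key_sum :: "('a \<Rightarrow> 'b \<Rightarrow> 'c) \<Rightarrow> ('a \<Rightarrow>\<^sub>0 'b::comm_monoid_add) \<Rightarrow> 'c::ab_group_add" where
  "key_sum h x = (\<Sum>w \<in> Poly_Mapping.keys x. h w (Poly_Mapping.lookup x w))"

lemma key_sum_add:
  assumes h: "\<And>w a b. h w (a + b) = h w a + h w b"
  shows "key_sum h (x + y) = key_sum h x + key_sum h y"
proof -
  let ?S = "Poly_Mapping.keys x \<union> Poly_Mapping.keys y"
  have h0: "h w 0 = 0" for w using h[of w 0 0] by simp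
  have ks: "key_sum h z = (\<Sum>w\<in>?S. h w (Poly_Mapping.lookup z w))" if "Poly_Mapping.keys z \<subseteq> ?S" for z
    unfolding key_sum_def by (rule sum.mono_neutral_left) (use that h0 in \<open>auto simp: in_keys_iff\<close>)
  show ?thesis
    using ks[of x] ks[of y] ks[of "x + y"] keys_add[of x y]
    by (simp add: lookup_add h sum.distrib)
qed

lemma key_sum_single:
  assumes h: "\<And>w a b. h w (a + b) = h w a + h w b"
  shows "key_sum h (Poly_Mapping.single w c) = h w c"
proof -
  have "h w 0 = 0" using h[of w 0 0] by simp
  then show ?thesis by (simp add: key_sum_def)
qed

section \<open>The involution and the scalars of the free algebra\<close>

lemma free_star_conv: "free_star = key_sum (\<lambda>w c. Poly_Mapping.single (word_star w) (cnj c))"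
  by (simp add: fun_eq_iff free_star_def key_sum_def)

lemma free_star_add: "free_star (x + y) = free_star x + free_star y"
  unfolding free_star_conv by (rule key_sum_add) (simp add: single_add)

lemma free_star_single [simp]:
  "free_star (Poly_Mapping.single w c) = Poly_Mapping.single (word_star w) (cnj c)"
  unfolding free_star_conv by (subst key_sum_single) (simp_all add: single_add)

lemma free_star_zero [simp]: "free_star 0 = 0"
  by (simp add: free_star_def)

lemma free_star_minus: "free_star (- x) = - free_star x"
  using free_star_add[of x "- x"] by (simp add: eq_neg_iff_add_eq_0 add.commute)

lemma free_star_diff: "free_star (x - y) = free_star x - free_star y"
  using free_star_add[of x "- y"] by (simp add: free_star_minus)

lemma free_star_sum: "free_star (sum f S) = (\<Sum>i\<in>S. free_star (f i))"
  by (induction S rule: infinite_finite_induct) (simp_all add: free_star_add)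

lemma word_star_plus: "word_star (u + v) = word_star v + word_star u"
  by (simp add: word_star_def plus_gen_word_def)

lemma gen_star_gen_star [simp]: "gen_star (gen_star g) = g"
  by (cases g) simp_all

lemma word_star_word_star [simp]: "word_star (word_star w) = w"
  by (cases w) (simp add: word_star_def rev_map o_def)

lemma free_star_mult: "free_star (x * y) = free_star y * free_star x"
  by (rule biadditive_eqI[of "\<lambda>x y. free_star (x * y)"])
    (simp_all add: free_star_add algebra_simps mult_single word_star_plus)

lemma free_star_free_star [simp]: "free_star (free_star x) = x"
  by (rule additive_eqI[of "\<lambda>x. free_star (free_star x)" "\<lambda>x. x"]) (simp_all add: free_star_add)

text \<open>Scalars are placed in the unital ring as multiples of the empty word;
  \<open>free_scale\<close> becomes a product, and ring identities apply to it.\<close>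

definition scalar :: "complex \<Rightarrow> ('v, 'e) free_elem" where
  "scalar c = Poly_Mapping.single 0 c"

lemma scalar_simps [simp]: "scalar 0 = 0" "scalar 1 = 1"
  by (simp_all add: scalar_def)

lemma scalar_add: "scalar (c + d) = scalar c + scalar d"
  by (simp add: scalar_def single_add)

lemma scalar_minus: "scalar (- c) = - scalar c"
  by (simp add: scalar_def single_uminus)

lemma scalar_mult: "scalar c * scalar d = scalar (c * d)"
  by (simp add: scalar_def mult_single)

lemma scalar_commute: "x * scalar c = scalar c * x"
  by (rule additive_eqI[of "\<lambda>x. x * scalar c" "\<lambda>x. scalar c * x"])
    (simp_all add: scalar_def algebra_simps mult_single)

lemma free_scale_eq: "free_scale c x = scalar c * x"
  unfolding free_scale_def scalar_def by (rule mult_map_scale_conv_mult)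

lemma word_star_zero [simp]: "word_star 0 = 0"
  by (simp add: word_star_def zero_gen_word_def)

lemma free_star_scalar [simp]: "free_star (scalar c) = scalar (cnj c)"
  by (simp add: scalar_def)

lemma free_star_gens [simp]:
  "free_star (edge_gen e) = ghost_gen e" "free_star (ghost_gen e) = edge_gen e"
  "free_star (proj_gen A) = proj_gen A"
  by (simp_all add: edge_gen_def ghost_gen_def proj_gen_def word_star_def)

lemma letters_plus [simp]: "letters (u + v) = letters u @ letters v"
  by (simp add: plus_gen_word_def)

lemma letters_zero [simp]: "letters 0 = []"
  by (simp add: zero_gen_word_def)

lemma letters_eq_Nil_iff [simp]: "letters w = [] \<longleftrightarrow> w = 0"
  by (cases w) (simp add: zero_gen_word_def)

lemma free_carrier_single:
  "c = 0 \<or> w \<noteq> 0 \<and> set (letters w) \<subseteq> generators G \<Longrightarrow> Poly_Mapping.single w c \<in> free_carrier G"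
  by (auto simp: free_carrier_def split: if_splits)

lemma free_carrier_add: "x \<in> free_carrier G \<Longrightarrow> y \<in> free_carrier G \<Longrightarrow> x + y \<in> free_carrier G"
  unfolding free_carrier_def using keys_add[of x y] by blast

lemma free_carrier_zero: "0 \<in> free_carrier G"
  by (simp add: free_carrier_def)

lemma free_carrier_scale: "x \<in> free_carrier G \<Longrightarrow> free_scale c x \<in> free_carrier G"
  unfolding free_carrier_def free_scale_eq scalar_def
  using keys_mult[of "Poly_Mapping.single 0 c" x] by (fastforce split: if_splits)

lemma free_carrier_minus: "x \<in> free_carrier G \<Longrightarrow> - x \<in> free_carrier G"
  by (simp add: free_carrier_def)

lemma free_carrier_diff: "x \<in> free_carrier G \<Longrightarrow> y \<in> free_carrier G \<Longrightarrow> x - y \<in> free_carrier G"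
  using free_carrier_add[OF _ free_carrier_minus] by (metis diff_conv_add_uminus)

lemma free_carrier_mult: "x \<in> free_carrier G \<Longrightarrow> y \<in> free_carrier G \<Longrightarrow> x * y \<in> free_carrier G"
  unfolding free_carrier_def using keys_mult[of x y] by fastforce

lemma free_carrier_sum: "(\<And>i. i \<in> S \<Longrightarrow> f i \<in> free_carrier G) \<Longrightarrow> sum f S \<in> free_carrier G"
  by (induction S rule: infinite_finite_induct) (auto simp: free_carrier_zero free_carrier_add)

lemma gen_star_generators: "gen_star g \<in> generators G \<longleftrightarrow> g \<in> generators G"
  by (cases g) (auto simp: generators_def)

lemma free_carrier_star:
  assumes "x \<in> free_carrier G" shows "free_star x \<in> free_carrier G"
  unfolding free_star_def
proof (intro free_carrier_sum free_carrier_single disjI2)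
  fix w assume "w \<in> Poly_Mapping.keys x"
  then have "letters w \<noteq> []" "set (letters w) \<subseteq> generators G"
    using assms by (auto simp: free_carrier_def)
  then show "word_star w \<noteq> 0 \<and> set (letters (word_star w)) \<subseteq> generators G"
    by (auto simp: word_star_def zero_gen_word_def gen_star_generators subset_iff)
qed

lemma free_carrier_gens:
  "e \<in> edges G \<Longrightarrow> edge_gen e \<in> free_carrier G" "e \<in> edges G \<Longrightarrow> ghost_gen e \<in> free_carrier G"
  "A \<in> gen_verts G \<Longrightarrow> proj_gen A \<in> free_carrier G"
  by (auto simp: edge_gen_def ghost_gen_def proj_gen_def generators_def zero_gen_word_def
      intro!: free_carrier_single)

lemma (in ultragraph) lpa_relators_carrier:
  "x \<in> lpa_relators G \<Longrightarrow> x \<in> free_carrier G"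
  by (induction rule: lpa_relators.induct)
    (auto intro!: free_carrier_gens free_carrier_diff free_carrier_mult free_carrier_add
      free_carrier_sum gen_Int gen_Un gen_empty gen_vertex gen_range src_in_verts free_carrier_zero
      simp: is_regular_def out_edges_def)

lemma lpa_ideal_scalar: "x \<in> lpa_ideal G \<Longrightarrow> scalar c * x \<in> lpa_ideal G"
  using ideal_scale[of x G c] by (simp add: free_scale_eq)

lemma lpa_ideal_minus: "x \<in> lpa_ideal G \<Longrightarrow> - x \<in> lpa_ideal G"
  using lpa_ideal_scalar[of x G "- 1"] by (simp add: scalar_minus)

lemma lpa_ideal_diff: "x \<in> lpa_ideal G \<Longrightarrow> y \<in> lpa_ideal G \<Longrightarrow> x - y \<in> lpa_ideal G"
  using ideal_add[OF _ lpa_ideal_minus] by (metis diff_conv_add_uminus)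

text \<open>Each relation is self-adjoint or has its adjoint among the relations: source and range
  relations for edges and ghosts are exchanged, and products of projections or of a ghost with an
  edge swap their factors.\<close>

lemma lpa_relators_star: "x \<in> lpa_relators G \<Longrightarrow> free_star x \<in> lpa_relators G"
proof (induction rule: lpa_relators.induct)
  case (rel_Int A B)
  then show ?case using lpa_relators.rel_Int[of B G A] by (simp add: free_star_diff free_star_mult Int_commute)
next
  case (rel_ghost_edge e f)
  then show ?case using lpa_relators.rel_ghost_edge[of f G e]
    by (simp add: free_star_diff free_star_mult eq_commute[of f] split: if_splits)
qed (auto simp: free_star_diff free_star_add free_star_mult free_star_sum intro: lpa_relators.intros)

lemma lpa_ideal_star: "x \<in> lpa_ideal G \<Longrightarrow> free_star x \<in> lpa_ideal G"
  by (induction rule: lpa_ideal.induct)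
    (auto simp: free_star_add free_star_mult free_scale_eq scalar_commute lpa_ideal_scalar
      intro: lpa_relators_star lpa_ideal.intros free_carrier_star)

section \<open>Congruence modulo the ideal\<close>

locale two_sided_ideal =
  fixes I :: "'a::ring_1 set"
  assumes zero_mem: "0 \<in> I"
    and add_mem: "x \<in> I \<Longrightarrow> y \<in> I \<Longrightarrow> x + y \<in> I"
    and mult_left_mem: "x \<in> I \<Longrightarrow> a * x \<in> I"
    and mult_right_mem: "x \<in> I \<Longrightarrow> x * a \<in> I"
begin

definition eqv :: "'a \<Rightarrow> 'a \<Rightarrow> bool" where
  "eqv x y \<longleftrightarrow> x - y \<in> I"

lemma minus_mem: "x \<in> I \<Longrightarrow> - x \<in> I"
  using mult_left_mem[of x "- 1"] by simp

lemma diff_mem: "x \<in> I \<Longrightarrow> y \<in> I \<Longrightarrow> x - y \<in> I"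
  using add_mem[OF _ minus_mem] by (metis diff_conv_add_uminus)

lemma sum_mem: "(\<And>i. i \<in> S \<Longrightarrow> f i \<in> I) \<Longrightarrow> sum f S \<in> I"
  by (induction S rule: infinite_finite_induct) (auto simp: zero_mem add_mem)

lemma eqv_zero: "eqv x 0 \<longleftrightarrow> x \<in> I"
  by (simp add: eqv_def)

lemma eqv_refl [simp, intro!]: "eqv x x"
  by (simp add: eqv_def zero_mem)

lemma eqv_sym: "eqv x y \<Longrightarrow> eqv y x"
  unfolding eqv_def using minus_mem[of "x - y"] by simp

lemma eqv_trans [trans]: "eqv x y \<Longrightarrow> eqv y z \<Longrightarrow> eqv x z"
  unfolding eqv_def using add_mem[of "x - y" "y - z"] by simp

lemma eqv_mem: "eqv x y \<Longrightarrow> x \<in> I \<longleftrightarrow> y \<in> I"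
  by (metis eqv_sym eqv_trans eqv_zero)

lemma eqv_add: "eqv x x' \<Longrightarrow> eqv y y' \<Longrightarrow> eqv (x + y) (x' + y')"
  unfolding eqv_def using add_mem[of "x - x'" "y - y'"] by (simp add: algebra_simps)

lemma eqv_diff: "eqv x x' \<Longrightarrow> eqv y y' \<Longrightarrow> eqv (x - y) (x' - y')"
  unfolding eqv_def using diff_mem[of "x - x'" "y - y'"] by (simp add: algebra_simps)

lemma eqv_mult: "eqv x x' \<Longrightarrow> eqv y y' \<Longrightarrow> eqv (x * y) (x' * y')"
  unfolding eqv_def
  using add_mem[OF mult_right_mem[of "x - x'" y] mult_left_mem[of "y - y'" x']]
  by (simp add: algebra_simps)

lemma eqv_mult_left: "eqv y y' \<Longrightarrow> eqv (x * y) (x * y')"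
  by (rule eqv_mult) simp_all

lemma eqv_mult_right: "eqv x x' \<Longrightarrow> eqv (x * y) (x' * y)"
  by (rule eqv_mult) simp_all

lemma eqv_sum: "(\<And>i. i \<in> S \<Longrightarrow> eqv (f i) (g i)) \<Longrightarrow> eqv (sum f S) (sum g S)"
  unfolding eqv_def sum_subtractf[symmetric] by (rule sum_mem)

end

text \<open>The largest extension of the defining ideal from the free non-unital algebra on the
  generators of \<open>G\<close> to the whole unital ring \<^typ>\<open>('v, 'e) free_elem\<close>, so that congruences may be
  multiplied by arbitrary elements.\<close>

definition restrict_gens :: "('v, 'e) pre_ultragraph \<Rightarrow> ('v, 'e) free_elem \<Rightarrow> ('v, 'e) free_elem" where
  "restrict_gens G = key_sum (\<lambda>w c. if set (letters w) \<subseteq> generators G then Poly_Mapping.single w c else 0)"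

definition lpa_ideal_ext :: "('v, 'e) pre_ultragraph \<Rightarrow> ('v, 'e) free_elem set" where
  "lpa_ideal_ext G = {x. restrict_gens G x \<in> lpa_ideal G}"

lemma restrict_gens_add: "restrict_gens G (x + y) = restrict_gens G x + restrict_gens G y"
  unfolding restrict_gens_def by (rule key_sum_add) (simp add: single_add)

lemma restrict_gens_single:
  "restrict_gens G (Poly_Mapping.single w c) =
     (if set (letters w) \<subseteq> generators G then Poly_Mapping.single w c else 0)"
  unfolding restrict_gens_def by (subst key_sum_single) (auto simp: single_add)

lemma restrict_gens_zero: "restrict_gens G 0 = 0"
  by (simp add: restrict_gens_def key_sum_def)

lemma restrict_gens_mult: "restrict_gens G (x * y) = restrict_gens G x * restrict_gens G y"
  by (rule biadditive_eqI[of "\<lambda>x y. restrict_gens G (x * y)"])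
    (auto simp: restrict_gens_add algebra_simps mult_single restrict_gens_single)

lemma restrict_gens_carrier: "x \<in> free_carrier G \<Longrightarrow> restrict_gens G x = x"
  using poly_mapping_sum_single[of x]
  by (simp add: restrict_gens_def key_sum_def free_carrier_def)

text \<open>The empty word is no element of \<open>free_carrier G\<close>, but it acts as a scalar,
  under which the ideal is closed.\<close>

lemma lpa_ideal_restrict_left: "x \<in> lpa_ideal G \<Longrightarrow> restrict_gens G a * x \<in> lpa_ideal G"
proof (induction a rule: poly_mapping_single_induct)
  case zero
  then show ?case by (simp add: restrict_gens_zero ideal_zero)
next
  case (single y w c)
  have "restrict_gens G (Poly_Mapping.single w c) * x \<in> lpa_ideal G"
  proof (cases "w = 0")
    case True
    then show ?thesis using lpa_ideal_scalar[OF single.prems, of c] by (simp add: restrict_gens_single scalar_def)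
  next
    case False
    then show ?thesis
      using single.prems by (auto simp: restrict_gens_single intro!: ideal_mult_left ideal_zero free_carrier_single)
  qed
  then show ?case using single by (simp add: restrict_gens_add distrib_right ideal_add)
qed

lemma lpa_ideal_restrict_right: "x \<in> lpa_ideal G \<Longrightarrow> x * restrict_gens G a \<in> lpa_ideal G"
proof (induction a rule: poly_mapping_single_induct)
  case zero
  then show ?case by (simp add: restrict_gens_zero ideal_zero)
next
  case (single y w c)
  have "x * restrict_gens G (Poly_Mapping.single w c) \<in> lpa_ideal G"
  proof (cases "w = 0")
    case True
    then show ?thesis using lpa_ideal_scalar[OF single.prems, of c] scalar_commute[of x c]
      by (simp add: restrict_gens_single scalar_def)
  next
    case False
    then show ?thesis
      using single.prems by (auto simp: restrict_gens_single intro!: ideal_mult_right ideal_zero free_carrier_single)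
  qed
  then show ?case using single by (simp add: restrict_gens_add distrib_left ideal_add)
qed

lemma two_sided_ideal_lpa: "two_sided_ideal (lpa_ideal_ext G)"
  by unfold_locales
    (auto simp: lpa_ideal_ext_def restrict_gens_zero restrict_gens_add restrict_gens_mult
      intro: ideal_zero ideal_add lpa_ideal_restrict_left lpa_ideal_restrict_right)

lemma lpa_ideal_ext_iff: "x \<in> free_carrier G \<Longrightarrow> x \<in> lpa_ideal_ext G \<longleftrightarrow> x \<in> lpa_ideal G"
  by (simp add: lpa_ideal_ext_def restrict_gens_carrier)

section \<open>Representations on boundary paths\<close>

text \<open>Matrix entries in the basis \<^term>\<open>boundary_paths G A\<close>, with gauge parameter \<open>z\<close>; letters that
  are not generators of \<open>G\<close> act as zero.\<close>

fun gen_mat :: "('v, 'e) pre_ultragraph \<Rightarrow> 'v set \<Rightarrow> complex \<Rightarrow> ('v, 'e) generator \<Rightarrow>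
    'e list \<Rightarrow> 'e list \<Rightarrow> complex" where
  "gen_mat G A z (Edge e) \<alpha> \<beta> =
     (if e \<in> edges G \<and> begins_in G A (rng G e) \<beta> \<and> \<alpha> = prepend G A e \<beta> then z else 0)"
| "gen_mat G A z (Ghost e) \<alpha> \<beta> =
     (if e \<in> edges G \<and> begins_in G A (rng G e) \<alpha> \<and> \<beta> = prepend G A e \<alpha> then cnj z else 0)"
| "gen_mat G A z (Proj B) \<alpha> \<beta> =
     (if B \<in> gen_verts G \<and> \<alpha> = \<beta> \<and> begins_in G A B \<alpha> then 1 else 0)"

fun word_mat :: "('v, 'e) pre_ultragraph \<Rightarrow> 'v set \<Rightarrow> complex \<Rightarrow> ('v, 'e) generator list \<Rightarrow>
    'e list \<Rightarrow> 'e list \<Rightarrow> complex" where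
  "word_mat G A z [] \<alpha> \<beta> = (if \<alpha> = \<beta> then 1 else 0)"
| "word_mat G A z (g # w) \<alpha> \<beta> =
     (\<Sum>\<gamma>\<in>boundary_paths G A. gen_mat G A z g \<alpha> \<gamma> * word_mat G A z w \<gamma> \<beta>)"

definition rep :: "('v, 'e) pre_ultragraph \<Rightarrow> 'v set \<Rightarrow> complex \<Rightarrow> 'e list \<Rightarrow> 'e list \<Rightarrow>
    ('v, 'e) free_elem \<Rightarrow> complex" where
  "rep G A z \<alpha> \<beta> = key_sum (\<lambda>w c. c * word_mat G A z (letters w) \<alpha> \<beta>)"

lemma rep_add: "rep G A z \<alpha> \<beta> (x + y) = rep G A z \<alpha> \<beta> x + rep G A z \<alpha> \<beta> y"
  unfolding rep_def by (rule key_sum_add) (simp add: distrib_right)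

lemma rep_single:
  "rep G A z \<alpha> \<beta> (Poly_Mapping.single w c) = c * word_mat G A z (letters w) \<alpha> \<beta>"
  unfolding rep_def by (subst key_sum_single) (simp_all add: distrib_right)

lemma rep_zero [simp]: "rep G A z \<alpha> \<beta> 0 = 0"
  by (simp add: rep_def key_sum_def)

lemma rep_diff: "rep G A z \<alpha> \<beta> (x - y) = rep G A z \<alpha> \<beta> x - rep G A z \<alpha> \<beta> y"
  using rep_add[of G A z \<alpha> \<beta> "x - y" y] by simp

lemma rep_sum: "rep G A z \<alpha> \<beta> (sum f S) = (\<Sum>i\<in>S. rep G A z \<alpha> \<beta> (f i))"
  by (induction S rule: infinite_finite_induct) (simp_all add: rep_add)

lemma gen_mat_star: "gen_mat G A z (gen_star g) \<alpha> \<beta> = cnj (gen_mat G A z g \<beta> \<alpha>)"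
  by (cases g) auto

lemma word_mat_outside:
  "\<not> set w \<subseteq> generators G \<Longrightarrow> word_mat G A z w \<alpha> \<beta> = 0"
proof (induction w arbitrary: \<alpha>)
  case (Cons g w)
  show ?case
  proof (cases "g \<in> generators G")
    case True
    then show ?thesis using Cons by simp
  next
    case False
    then have "gen_mat G A z g \<alpha> \<gamma> = 0" for \<gamma> by (cases g) (auto simp: generators_def)
    then show ?thesis by simp
  qed
qed simp

text \<open>This is what lets a representation that kills \<open>lpa_ideal G\<close> also kill its
  extension \<open>lpa_ideal_ext G\<close>.\<close>

lemma rep_restrict_gens: "rep G A z \<alpha> \<beta> (restrict_gens G x) = rep G A z \<alpha> \<beta> x"
  by (rule additive_eqI[of "\<lambda>x. rep G A z \<alpha> \<beta> (restrict_gens G x)"])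
    (auto simp: rep_add restrict_gens_add restrict_gens_single rep_single word_mat_outside)

section \<open>Gauge twist and homogeneous parts\<close>

fun gen_degree :: "('v, 'e) generator \<Rightarrow> int" where
  "gen_degree (Edge e) = 1"
| "gen_degree (Ghost e) = -1"
| "gen_degree (Proj A) = 0"

definition word_degree :: "('v, 'e) generator list \<Rightarrow> int" where
  "word_degree w = sum_list (map gen_degree w)"

text \<open>On the unit circle the conjugate is the inverse, so edges and ghosts contribute opposite
  powers of z.\<close>

lemma gen_mat_gauge:
  assumes "cmod z = 1"
  shows "gen_mat G A z g \<alpha> \<beta> = z powi gen_degree g * gen_mat G A 1 g \<alpha> \<beta>"
proof -
  have "cnj z = inverse z"
    using assms complex_norm_square[of z] by (intro inverse_unique[symmetric]) simp
  then show ?thesis by (cases g) (simp_all add: power_int_minus)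
qed

lemma word_mat_gauge:
  assumes "cmod z = 1"
  shows "word_mat G A z w \<alpha> \<beta> = z powi word_degree w * word_mat G A 1 w \<alpha> \<beta>"
proof -
  have z: "z \<noteq> 0" using assms by auto
  show ?thesis
  proof (induction w arbitrary: \<alpha>)
    case (Cons g w)
    have "z powi word_degree (g # w) = z powi gen_degree g * z powi word_degree w"
      using z by (simp add: word_degree_def power_int_add)
    then show ?case
      using assms
      by (simp add: Cons gen_mat_gauge[of z] sum_distrib_left mult_ac del: gen_mat.simps)
  qed (simp add: word_degree_def)
qed

text \<open>After multiplication by a power of z that clears the negative exponents, the sum is a
  polynomial with infinitely many roots.\<close>

lemma powi_sum_eq_zero:
  fixes c :: "int \<Rightarrow> complex"
  assumes D: "finite D" and 0: "\<And>z. cmod z = 1 \<Longrightarrow> (\<Sum>n\<in>D. z powi n * c n) = 0" and n: "n \<in> D"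
  shows "c n = 0"
proof -
  obtain N where N: "\<And>n. n \<in> D \<Longrightarrow> n + int N \<ge> 0"
  proof -
    have "bdd_below D" using D by simp
    then obtain m where "\<And>n. n \<in> D \<Longrightarrow> m \<le> n" by (auto simp: bdd_below_def)
    then show ?thesis using that[of "nat (- m)"] by fastforce
  qed
  define p where "p = (\<Sum>n\<in>D. Polynomial.monom (c n) (nat (n + int N)))"
  have "poly p z = 0" if z: "cmod z = 1" for z
  proof -
    have "z \<noteq> 0" using z by auto
    have "z ^ nat (n + int N) = z ^ N * z powi n" if "n \<in> D" for n
    proof -
      have "z ^ nat (n + int N) = z powi (n + int N)" using N[OF that] by (simp add: power_int_def)
      then show ?thesis using \<open>z \<noteq> 0\<close> by (simp add: power_int_add)
    qed
    then have "poly p z = z ^ N * (\<Sum>n\<in>D. z powi n * c n)"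
      by (simp add: p_def poly_sum poly_monom sum_distrib_left mult_ac)
    then show ?thesis using 0[OF z] by simp
  qed
  then have sub: "{z. cmod z = 1} \<subseteq> {z. poly p z = 0}" by auto
  have "infinite {z :: complex. cmod z = 1}"
  proof
    assume fin: "finite {z :: complex. cmod z = 1}"
    \<comment> \<open>If the circle were finite, the k-th roots of unity alone would outnumber it by
      one.\<close>
    define k where "k = Suc (card {z :: complex. cmod z = 1})"
    have "{z :: complex. z ^ k = 1} \<subseteq> {z. cmod z = 1}"
    proof
      fix z :: complex assume "z \<in> {z. z ^ k = 1}"
      then have "cmod z ^ k = 1" by (simp flip: norm_power)
      then have "cmod z = 1" by (rule power_eq_imp_eq_base[of _ k 1, simplified]) (simp_all add: k_def)
      then show "z \<in> {z. cmod z = 1}" by simp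
    qed
    then have "card {z :: complex. z ^ k = 1} \<le> card {z :: complex. cmod z = 1}"
      using fin by (rule card_mono[rotated])
    then show False using card_roots_unity_eq[of k] by (simp add: k_def)
  qed
  then have "p = 0" using sub poly_roots_finite[of p] finite_subset by blast
  then have "0 = Polynomial.coeff p (nat (n + int N))" by simp
  also have "\<dots> = (\<Sum>m\<in>D. if m = n then c m else 0)"
    unfolding p_def coeff_sum coeff_monom
    by (rule sum.cong) (use N[OF n] N in \<open>auto simp: nat_eq_iff\<close>)
  also have "\<dots> = c n" using D n by simp
  finally show ?thesis by simp
qed

definition hom_part :: "int \<Rightarrow> ('v, 'e) free_elem \<Rightarrow> ('v, 'e) free_elem" where
  "hom_part n x = (\<Sum>w \<in> {w \<in> Poly_Mapping.keys x. word_degree (letters w) = n}.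
     Poly_Mapping.single w (Poly_Mapping.lookup x w))"

lemma sum_hom_part:
  "(\<Sum>n \<in> (\<lambda>w. word_degree (letters w)) ` Poly_Mapping.keys x. hom_part n x) = x"
proof -
  have "(\<Sum>n \<in> (\<lambda>w. word_degree (letters w)) ` Poly_Mapping.keys x. hom_part n x) =
      (\<Sum>w \<in> Poly_Mapping.keys x. Poly_Mapping.single w (Poly_Mapping.lookup x w))"
    unfolding hom_part_def by (rule sum.image_gen[symmetric]) simp
  then show ?thesis by (simp only: poly_mapping_sum_single[symmetric])
qed

lemma keys_hom_part:
  "w \<in> Poly_Mapping.keys (hom_part n x) \<Longrightarrow> w \<in> Poly_Mapping.keys x \<and> word_degree (letters w) = n"
  using keys_sum[of "\<lambda>w. Poly_Mapping.single w (Poly_Mapping.lookup x w)"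
      "{w \<in> Poly_Mapping.keys x. word_degree (letters w) = n}"]
  by (auto simp: hom_part_def split: if_splits)

lemma rep_gauge:
  assumes "cmod z = 1" "\<And>w. w \<in> Poly_Mapping.keys x \<Longrightarrow> word_degree (letters w) = n"
  shows "rep G A z \<alpha> \<beta> x = z powi n * rep G A 1 \<alpha> \<beta> x"
  unfolding rep_def key_sum_def sum_distrib_left
  by (rule sum.cong) (simp_all add: assms word_mat_gauge[of z] mult_ac)

definition rep_kernel :: "('v, 'e) pre_ultragraph \<Rightarrow> ('v, 'e) free_elem set" where
  "rep_kernel G = {x. \<forall>A z. \<forall>\<alpha> \<in> boundary_paths G A. \<forall>\<beta> \<in> boundary_paths G A.
     prime_boundary G A \<and> A \<subseteq> verts G \<and> cmod z = 1 \<longrightarrow> rep G A z \<alpha> \<beta> x = 0}"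

text \<open>On the circle each matrix entry of x is a Laurent polynomial in z, whose coefficients
  are the entries of the homogeneous parts at z = 1. They all vanish when the polynomial
  does.\<close>

lemma rep_kernel_hom_part:
  assumes x: "x \<in> rep_kernel G"
  shows "hom_part n x \<in> rep_kernel G"
proof (cases "n \<in> (\<lambda>w. word_degree (letters w)) ` Poly_Mapping.keys x")
  case False
  then have "{w \<in> Poly_Mapping.keys x. word_degree (letters w) = n} = {}" by auto
  then have "hom_part n x = 0" unfolding hom_part_def by (simp only: sum.empty)
  then show ?thesis by (simp add: rep_kernel_def)
next
  case True
  let ?D = "(\<lambda>w. word_degree (letters w)) ` Poly_Mapping.keys x"
  have gauge: "rep G A z \<alpha> \<beta> (hom_part m x) = z powi m * rep G A 1 \<alpha> \<beta> (hom_part m x)"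
    if "cmod z = 1" for A z \<alpha> \<beta> m
    using that keys_hom_part by (intro rep_gauge) blast+
  have zero: "rep G A 1 \<alpha> \<beta> (hom_part n x) = 0"
    if A: "prime_boundary G A" "A \<subseteq> verts G" "\<alpha> \<in> boundary_paths G A" "\<beta> \<in> boundary_paths G A" for A \<alpha> \<beta>
  proof (rule powi_sum_eq_zero[of ?D "\<lambda>n. rep G A 1 \<alpha> \<beta> (hom_part n x)"])
    fix z :: complex assume z: "cmod z = 1"
    have "0 = rep G A z \<alpha> \<beta> x" using x A z by (simp add: rep_kernel_def)
    also have "\<dots> = (\<Sum>n\<in>?D. rep G A z \<alpha> \<beta> (hom_part n x))"
      by (subst sum_hom_part[symmetric]) (rule rep_sum)
    also have "\<dots> = (\<Sum>n\<in>?D. z powi n * rep G A 1 \<alpha> \<beta> (hom_part n x))"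
      using gauge[OF z] by simp
    finally show "(\<Sum>n\<in>?D. z powi n * rep G A 1 \<alpha> \<beta> (hom_part n x)) = 0" by simp
  qed (use True in auto)
  have "rep G A z \<alpha> \<beta> (hom_part n x) = 0"
    if "prime_boundary G A" "A \<subseteq> verts G" "\<alpha> \<in> boundary_paths G A" "\<beta> \<in> boundary_paths G A"
      and z: "cmod z = 1" for A z \<alpha> \<beta>
    unfolding gauge[OF z] zero[OF that(1-4)] by simp
  then show ?thesis unfolding rep_kernel_def by blast
qed

section \<open>The defining relations on boundary paths\<close>

locale boundary_rep = rfd_ultragraph +
  fixes A :: "'a set" and z :: complex
  assumes A: "prime_boundary G A" "A \<subseteq> verts G" and z: "cmod z = 1"
begin

abbreviation "X \<equiv> boundary_paths G A"

lemma finite_X: "finite X"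
  using A finite_boundary_paths by (simp add: prime_boundary_def)

lemma z_cnj [simp]: "z * cnj z = 1" "cnj z * z = 1"
  using complex_norm_square[of z] z by (simp_all add: mult.commute)

lemma word_mat_append:
  "\<alpha> \<in> X \<Longrightarrow> word_mat G A z (u @ w) \<alpha> \<beta> = (\<Sum>\<gamma>\<in>X. word_mat G A z u \<alpha> \<gamma> * word_mat G A z w \<gamma> \<beta>)"
proof (induction u arbitrary: \<alpha>)
  case Nil
  then show ?case using finite_X by (simp add: if_distrib[of "\<lambda>a. a * _"] cong: if_cong)
next
  case (Cons g u)
  have "word_mat G A z ((g # u) @ w) \<alpha> \<beta> =
      (\<Sum>\<gamma>\<in>X. \<Sum>\<delta>\<in>X. gen_mat G A z g \<alpha> \<gamma> * word_mat G A z u \<gamma> \<delta> * word_mat G A z w \<delta> \<beta>)"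
    by (simp add: Cons.IH sum_distrib_left mult.assoc)
  also have "\<dots> = (\<Sum>\<delta>\<in>X. \<Sum>\<gamma>\<in>X. gen_mat G A z g \<alpha> \<gamma> * word_mat G A z u \<gamma> \<delta> * word_mat G A z w \<delta> \<beta>)"
    by (rule sum.swap)
  finally show ?case by (simp add: sum_distrib_right)
qed

lemma word_mat_single:
  "\<beta> \<in> X \<Longrightarrow> word_mat G A z [g] \<alpha> \<beta> = gen_mat G A z g \<alpha> \<beta>"
  using finite_X by (simp add: if_distrib[of "\<lambda>a. _ * a"] cong: if_cong)

lemma word_mat_star:
  "\<alpha> \<in> X \<Longrightarrow> \<beta> \<in> X \<Longrightarrow> word_mat G A z (rev (map gen_star w)) \<alpha> \<beta> = cnj (word_mat G A z w \<beta> \<alpha>)"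
proof (induction w arbitrary: \<beta>)
  case (Cons g w)
  have "word_mat G A z (rev (map gen_star (g # w))) \<alpha> \<beta> =
      (\<Sum>\<gamma>\<in>X. word_mat G A z (rev (map gen_star w)) \<alpha> \<gamma> * word_mat G A z [gen_star g] \<gamma> \<beta>)"
    using Cons.prems by (simp only: list.map rev.simps word_mat_append)
  also have "\<dots> = (\<Sum>\<gamma>\<in>X. cnj (word_mat G A z w \<gamma> \<alpha>) * cnj (gen_mat G A z g \<beta> \<gamma>))"
    using Cons.prems by (intro sum.cong refl) (simp only: Cons.IH word_mat_single gen_mat_star)
  finally show ?case by (simp add: mult.commute)
qed simp

lemma rep_mult:
  assumes "\<alpha> \<in> X"
  shows "rep G A z \<alpha> \<beta> (x * y) = (\<Sum>\<gamma>\<in>X. rep G A z \<alpha> \<gamma> x * rep G A z \<gamma> \<beta> y)"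
  by (rule biadditive_eqI[of "\<lambda>x y. rep G A z \<alpha> \<beta> (x * y)"])
    (simp_all add: rep_add distrib_left distrib_right sum.distrib mult_single rep_single
      word_mat_append[OF assms] sum_distrib_left mult_ac)

lemma rep_scalar:
  assumes "\<alpha> \<in> X" "\<beta> \<in> X" shows "rep G A z \<alpha> \<beta> (scalar c * x) = c * rep G A z \<alpha> \<beta> x"
  by (rule additive_eqI[of "\<lambda>x. rep G A z \<alpha> \<beta> (scalar c * x)"])
    (simp_all add: rep_add distrib_left scalar_def mult_single rep_single mult_ac)

lemma rep_star:
  assumes "\<alpha> \<in> X" "\<beta> \<in> X"
  shows "rep G A z \<alpha> \<beta> (free_star x) = cnj (rep G A z \<beta> \<alpha> x)"
  by (rule additive_eqI[of "\<lambda>x. rep G A z \<alpha> \<beta> (free_star x)"])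
    (simp_all add: rep_add free_star_add rep_single word_star_def word_mat_star assms)

lemma rep_gens:
  assumes "\<beta> \<in> X"
  shows "rep G A z \<alpha> \<beta> (edge_gen e) = gen_mat G A z (Edge e) \<alpha> \<beta>"
    "rep G A z \<alpha> \<beta> (ghost_gen e) = gen_mat G A z (Ghost e) \<alpha> \<beta>"
    "rep G A z \<alpha> \<beta> (proj_gen B) = gen_mat G A z (Proj B) \<alpha> \<beta>"
  unfolding edge_gen_def ghost_gen_def proj_gen_def
  by (simp_all only: rep_single word_mat_single[OF assms] gen_word.sel mult_1)

lemma rep_proj_mult:
  assumes "\<alpha> \<in> X" "B \<in> gen_verts G"
  shows "rep G A z \<alpha> \<beta> (proj_gen B * x) = (if begins_in G A B \<alpha> then rep G A z \<alpha> \<beta> x else 0)"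
proof -
  have "rep G A z \<alpha> \<beta> (proj_gen B * x) =
      (\<Sum>\<gamma>\<in>X. if \<gamma> = \<alpha> then if begins_in G A B \<alpha> then rep G A z \<alpha> \<beta> x else 0 else 0)"
    unfolding rep_mult[OF assms(1)]
    by (rule sum.cong) (use assms in \<open>auto simp: rep_gens\<close>)
  then show ?thesis using assms finite_X by simp
qed

lemma rep_mult_proj:
  assumes "\<alpha> \<in> X" "\<beta> \<in> X" "B \<in> gen_verts G"
  shows "rep G A z \<alpha> \<beta> (x * proj_gen B) = (if begins_in G A B \<beta> then rep G A z \<alpha> \<beta> x else 0)"
proof -
  have "rep G A z \<alpha> \<beta> (x * proj_gen B) =
      (\<Sum>\<gamma>\<in>X. if \<gamma> = \<beta> then if begins_in G A B \<beta> then rep G A z \<alpha> \<beta> x else 0 else 0)"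
    unfolding rep_mult[OF assms(1)]
    by (rule sum.cong) (use assms in \<open>auto simp: rep_gens\<close>)
  then show ?thesis using assms finite_X by simp
qed

text \<open>The only possible intermediate path is \<open>prepend G A e \<alpha>\<close>; that it
  also arises from f and \<beta> is excluded by \<open>prepend_inj\<close> unless e = f and \<alpha>
  = \<beta>.\<close>

lemma rep_ghost_edge:
  assumes \<alpha>: "\<alpha> \<in> X" and \<beta>: "\<beta> \<in> X" and e: "e \<in> edges G" and f: "f \<in> edges G"
  shows "rep G A z \<alpha> \<beta> (ghost_gen e * edge_gen f) =
    (if e = f \<and> \<alpha> = \<beta> \<and> begins_in G A (rng G e) \<alpha> then 1 else 0)"
proof -
  have "rep G A z \<alpha> \<beta> (ghost_gen e * edge_gen f) =
      (\<Sum>\<gamma>\<in>X. if \<gamma> = prepend G A e \<alpha> then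
        if begins_in G A (rng G e) \<alpha> \<and> begins_in G A (rng G f) \<beta> \<and> prepend G A e \<alpha> = prepend G A f \<beta>
        then 1 else 0 else 0)"
    unfolding rep_mult[OF \<alpha>]
    by (rule sum.cong) (use \<beta> e f in \<open>auto simp: rep_gens\<close>)
  also have "\<dots> = (if begins_in G A (rng G e) \<alpha> \<and> begins_in G A (rng G f) \<beta> \<and>
      prepend G A e \<alpha> = prepend G A f \<beta> then 1 else 0)"
    using finite_X prepend_in_boundary_paths[OF e \<alpha>] by auto
  also have "\<dots> = (if e = f \<and> \<alpha> = \<beta> \<and> begins_in G A (rng G e) \<alpha> then 1 else 0)"
    using prepend_inj[OF e f \<alpha> \<beta>] by auto
  finally show ?thesis .
qed

text \<open>The product is the projection onto the paths that e can produce: by injectivity at most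
  one intermediate path contributes.\<close>

lemma rep_edge_ghost:
  assumes \<alpha>: "\<alpha> \<in> X" and \<beta>: "\<beta> \<in> X" and e: "e \<in> edges G"
  shows "rep G A z \<alpha> \<beta> (edge_gen e * ghost_gen e) =
    (if \<alpha> = \<beta> \<and> (\<exists>\<gamma>\<in>X. begins_in G A (rng G e) \<gamma> \<and> \<alpha> = prepend G A e \<gamma>) then 1 else 0)"
proof -
  have s: "rep G A z \<alpha> \<beta> (edge_gen e * ghost_gen e) =
      (\<Sum>\<gamma>\<in>X. if begins_in G A (rng G e) \<gamma> \<and> \<alpha> = prepend G A e \<gamma> \<and> \<beta> = prepend G A e \<gamma> then 1 else 0)"
    unfolding rep_mult[OF \<alpha>]
    by (rule sum.cong) (use \<beta> e in \<open>auto simp: rep_gens\<close>)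
  show ?thesis
  proof (cases "\<alpha> = \<beta> \<and> (\<exists>\<gamma>\<in>X. begins_in G A (rng G e) \<gamma> \<and> \<alpha> = prepend G A e \<gamma>)")
    case True
    then obtain \<gamma>0 where g: "\<gamma>0 \<in> X" "begins_in G A (rng G e) \<gamma>0" "\<alpha> = prepend G A e \<gamma>0" by blast
    have "(\<Sum>\<gamma>\<in>X. if begins_in G A (rng G e) \<gamma> \<and> \<alpha> = prepend G A e \<gamma> \<and> \<beta> = prepend G A e \<gamma> then 1 else 0)
       = (\<Sum>\<gamma>\<in>X. if \<gamma> = \<gamma>0 then 1 else (0::complex))"
      by (rule sum.cong) (use prepend_inj[OF e e _ g(1) _ g(2)] g True in auto)
    then have "rep G A z \<alpha> \<beta> (edge_gen e * ghost_gen e) = 1" using s g(1) finite_X by simp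
    then show ?thesis unfolding if_P[OF True] .
  next
    case False
    then have "(\<Sum>\<gamma>\<in>X. if begins_in G A (rng G e) \<gamma> \<and> \<alpha> = prepend G A e \<gamma> \<and> \<beta> = prepend G A e \<gamma>
        then 1 else (0::complex)) = 0"
      by (intro sum.neutral) auto
    then show ?thesis unfolding s if_not_P[OF False] .
  qed
qed

text \<open>Every basis path beginning in v arises from an edge by \<open>regular_prepend\<close>,
  and from only one by \<open>prepend_inj\<close>, so exactly one summand is 1.\<close>

lemma rep_regular:
  assumes \<alpha>: "\<alpha> \<in> X" and \<beta>: "\<beta> \<in> X" and v: "is_regular G v"
  shows "(\<Sum>e \<in> out_edges G {v}. rep G A z \<alpha> \<beta> (edge_gen e * ghost_gen e)) =
    (if \<alpha> = \<beta> \<and> begins_in G A {v} \<alpha> then 1 else 0)"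
proof (cases "\<alpha> = \<beta> \<and> begins_in G A {v} \<alpha>")
  case True
  then obtain e \<gamma> where e: "e \<in> edges G" "src G e = v" "\<gamma> \<in> X" "begins_in G A (rng G e) \<gamma>"
    "\<alpha> = prepend G A e \<gamma>"
    using regular_prepend[OF A(1) v \<alpha>] by blast
  have "rep G A z \<alpha> \<beta> (edge_gen f * ghost_gen f) = (if f = e then 1 else 0)" if "f \<in> edges G" for f
  proof -
    have "(\<exists>\<gamma>\<in>X. begins_in G A (rng G f) \<gamma> \<and> \<alpha> = prepend G A f \<gamma>) \<longleftrightarrow> f = e"
    proof
      assume "\<exists>\<gamma>\<in>X. begins_in G A (rng G f) \<gamma> \<and> \<alpha> = prepend G A f \<gamma>"
      then obtain \<delta> where d: "\<delta> \<in> X" "begins_in G A (rng G f) \<delta>" "\<alpha> = prepend G A f \<delta>" by blast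
      show "f = e" using prepend_inj[OF that e(1) d(1) e(3) d(2) e(4)] d(3)[symmetric] e(5) by simp
    next
      assume "f = e"
      then show "\<exists>\<gamma>\<in>X. begins_in G A (rng G f) \<gamma> \<and> \<alpha> = prepend G A f \<gamma>" using e(3-5) by blast
    qed
    then show ?thesis unfolding rep_edge_ghost[OF \<alpha> \<beta> that] using True by simp
  qed
  then have "(\<Sum>f \<in> out_edges G {v}. rep G A z \<alpha> \<beta> (edge_gen f * ghost_gen f)) =
      (\<Sum>f \<in> out_edges G {v}. if f = e then 1 else 0)"
    by (intro sum.cong) (auto simp: out_edges_def)
  moreover have "e \<in> out_edges G {v}" "finite (out_edges G {v})"
    using e v by (auto simp: out_edges_def is_regular_def)
  ultimately show ?thesis unfolding if_P[OF True] by simp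
next
  case False
  have "rep G A z \<alpha> \<beta> (edge_gen f * ghost_gen f) = 0" if "f \<in> out_edges G {v}" for f
  proof -
    have "f \<in> edges G" "src G f = v" using that by (auto simp: out_edges_def)
    then show ?thesis
      using rep_edge_ghost[OF \<alpha> \<beta>, of f] begins_in_prepend[of G A f] False by (auto split: if_splits)
  qed
  then show ?thesis unfolding if_not_P[OF False] by (rule sum.neutral[OF ballI])
qed

lemma rep_relator:
  "x \<in> lpa_relators G \<Longrightarrow> \<alpha> \<in> X \<Longrightarrow> \<beta> \<in> X \<Longrightarrow> rep G A z \<alpha> \<beta> x = 0"
proof (induction rule: lpa_relators.induct)
  case rel_empty
  then show ?case using A begins_in_empty[of A G \<alpha>] by (simp add: rep_gens prime_boundary_def)
next
  case (rel_Int B C)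
  then show ?case by (auto simp: rep_diff rep_proj_mult rep_gens begins_in_Int gen_Int)
next
  case (rel_Un B C)
  then show ?case using begins_in_Un[OF A(1) rel_Un(1,2), of \<alpha>]
    by (auto simp: rep_diff rep_add rep_gens begins_in_Int gen_Int gen_Un)
next
  case (rel_src_edge e)
  then show ?case using begins_in_prepend[of G A e]
    by (auto simp: rep_diff rep_proj_mult rep_gens gen_vertex src_in_verts)
next
  case (rel_edge_rng e)
  then show ?case by (auto simp: rep_diff rep_mult_proj rep_gens gen_range)
next
  case (rel_rng_ghost e)
  then show ?case by (auto simp: rep_diff rep_proj_mult rep_gens gen_range)
next
  case (rel_ghost_src e)
  then show ?case using begins_in_prepend[of G A e]
    by (auto simp: rep_diff rep_mult_proj rep_gens gen_vertex src_in_verts)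
next
  case (rel_ghost_edge e f)
  then show ?case by (auto simp: rep_diff rep_ghost_edge rep_gens gen_range)
next
  case (rel_regular v)
  then show ?case
    by (auto simp: rep_diff rep_sum rep_regular rep_gens gen_vertex is_regular_def)
qed

lemma rep_ideal:
  "x \<in> lpa_ideal G \<Longrightarrow> \<alpha> \<in> X \<Longrightarrow> \<beta> \<in> X \<Longrightarrow> rep G A z \<alpha> \<beta> x = 0"
  by (induction arbitrary: \<alpha> \<beta> rule: lpa_ideal.induct)
    (simp_all add: rep_relator rep_add free_scale_eq rep_scalar rep_mult)

end

context rfd_ultragraph
begin

lemma boundary_rep: "prime_boundary G A \<Longrightarrow> A \<subseteq> verts G \<Longrightarrow> cmod z = 1 \<Longrightarrow> boundary_rep G A z"
  by unfold_locales

lemma two_sided_ideal_rep_kernel: "two_sided_ideal (rep_kernel G)"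
  by unfold_locales (auto simp: rep_kernel_def rep_add boundary_rep.rep_mult[OF boundary_rep])

lemma lpa_ideal_ext_subset_rep_kernel: "lpa_ideal_ext G \<subseteq> rep_kernel G"
proof
  fix x assume "x \<in> lpa_ideal_ext G"
  then have x: "restrict_gens G x \<in> lpa_ideal G" by (simp add: lpa_ideal_ext_def)
  have "rep G A z \<alpha> \<beta> x = 0"
    if "prime_boundary G A" "A \<subseteq> verts G" "cmod z = 1" "\<alpha> \<in> boundary_paths G A" "\<beta> \<in> boundary_paths G A"
    for A z \<alpha> \<beta>
    using boundary_rep.rep_ideal[OF boundary_rep[OF that(1-3)] x that(4,5)] by (simp add: rep_restrict_gens)
  then show "x \<in> rep_kernel G" unfolding rep_kernel_def by blast
qed

lemma rep_kernel_star: "x \<in> rep_kernel G \<Longrightarrow> free_star x \<in> rep_kernel G"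
  unfolding rep_kernel_def by (auto simp: boundary_rep.rep_star[OF boundary_rep])

text \<open>Here (B4) enters: a boundary path from v is a basis vector that the projection of v
  fixes.\<close>

lemma vertex_notin_rep_kernel:
  assumes "v \<in> verts G"
  shows "proj_gen {v} \<notin> rep_kernel G"
proof -
  obtain A \<alpha> where A: "prime_boundary G A" "A \<subseteq> verts G" "\<alpha> \<in> boundary_paths G A" "begins_in G A {v} \<alpha>"
    using vertex_reaches_boundary[OF assms] by blast
  have "rep G A 1 \<alpha> \<alpha> (proj_gen {v}) = 1"
    using A assms boundary_rep.rep_gens(3)[OF boundary_rep[of A 1]] by (simp add: gen_vertex)
  then show ?thesis using A unfolding rep_kernel_def by force
qed

end

section \<open>Ideals containing no vertex\<close>

context ultragraph
begin

sublocale J: two_sided_ideal "lpa_ideal_ext G"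
  by (rule two_sided_ideal_lpa)

notation J.eqv (infix "\<approx>" 50)

section \<open>Calculation with the defining relations\<close>

lemma relator_eqv: "x - y \<in> lpa_relators G \<Longrightarrow> x \<approx> y"
  by (simp add: J.eqv_def lpa_ideal_ext_iff lpa_relators_carrier ideal_relator)

lemma proj_empty: "proj_gen {} \<approx> 0"
  by (rule relator_eqv) (simp add: rel_empty)

lemma proj_Int:
  "A \<in> gen_verts G \<Longrightarrow> B \<in> gen_verts G \<Longrightarrow> proj_gen A * proj_gen B \<approx> proj_gen (A \<inter> B)"
  by (rule relator_eqv) (rule rel_Int)

lemma proj_Un:
  "A \<in> gen_verts G \<Longrightarrow> B \<in> gen_verts G \<Longrightarrow>
     proj_gen (A \<union> B) \<approx> proj_gen A + proj_gen B - proj_gen (A \<inter> B)"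
  by (rule relator_eqv) (rule rel_Un)

lemma edge_proj_rng: "e \<in> edges G \<Longrightarrow> edge_gen e * proj_gen (rng G e) \<approx> edge_gen e"
  by (rule relator_eqv) (rule rel_edge_rng)

lemma proj_rng_ghost: "e \<in> edges G \<Longrightarrow> proj_gen (rng G e) * ghost_gen e \<approx> ghost_gen e"
  by (rule relator_eqv) (rule rel_rng_ghost)

lemma ghost_edge:
  "e \<in> edges G \<Longrightarrow> f \<in> edges G \<Longrightarrow>
     ghost_gen e * edge_gen f \<approx> (if e = f then proj_gen (rng G e) else 0)"
  by (rule relator_eqv) (rule rel_ghost_edge)

lemma proj_regular:
  "is_regular G v \<Longrightarrow> proj_gen {v} \<approx> (\<Sum>e \<in> out_edges G {v}. edge_gen e * ghost_gen e)"
  by (rule relator_eqv) (rule rel_regular)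

text \<open>Inserting the source projection in front of the edge leaves a product of two set
  projections, which is that of the source or of the empty set.\<close>

lemma proj_edge:
  assumes "e \<in> edges G" "A \<in> gen_verts G"
  shows "proj_gen A * edge_gen e \<approx> (if src G e \<in> A then edge_gen e else 0)"
proof -
  have src: "{src G e} \<in> gen_verts G" by (rule gen_vertex[OF src_in_verts[OF assms(1)]])
  have se: "proj_gen {src G e} * edge_gen e \<approx> edge_gen e"
    using assms by (intro relator_eqv rel_src_edge)
  have "proj_gen A * edge_gen e \<approx> proj_gen A * (proj_gen {src G e} * edge_gen e)"
    by (rule J.eqv_mult_left, rule J.eqv_sym, rule se)
  also have "\<dots> = (proj_gen A * proj_gen {src G e}) * edge_gen e" by (simp add: mult.assoc)
  also have "\<dots> \<approx> proj_gen (A \<inter> {src G e}) * edge_gen e"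
    by (rule J.eqv_mult_right, rule proj_Int[OF assms(2) src])
  also have "\<dots> \<approx> (if src G e \<in> A then edge_gen e else 0)"
    using se J.eqv_mult_right[OF proj_empty, of "edge_gen e"] by simp
  finally show ?thesis .
qed

lemma ghost_proj:
  assumes "e \<in> edges G" "A \<in> gen_verts G"
  shows "ghost_gen e * proj_gen A \<approx> (if src G e \<in> A then ghost_gen e else 0)"
proof -
  have src: "{src G e} \<in> gen_verts G" by (rule gen_vertex[OF src_in_verts[OF assms(1)]])
  have se: "ghost_gen e * proj_gen {src G e} \<approx> ghost_gen e"
    using assms by (intro relator_eqv rel_ghost_src)
  have "ghost_gen e * proj_gen A \<approx> (ghost_gen e * proj_gen {src G e}) * proj_gen A"
    by (rule J.eqv_mult_right, rule J.eqv_sym, rule se)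
  also have "\<dots> = ghost_gen e * (proj_gen {src G e} * proj_gen A)" by (simp add: mult.assoc)
  also have "\<dots> \<approx> ghost_gen e * proj_gen ({src G e} \<inter> A)"
    by (rule J.eqv_mult_left, rule proj_Int[OF src assms(2)])
  also have "\<dots> \<approx> (if src G e \<in> A then ghost_gen e else 0)"
    using se J.eqv_mult_left[OF proj_empty, of "ghost_gen e"] by simp
  finally show ?thesis .
qed

text \<open>The spanning elements \<open>s\<^sub>\<alpha> p\<^sub>A s\<^sub>\<beta>\<^sup>*\<close>. Zero is among them up to congruence, as the case \<open>A = {}\<close>;
  likewise \<open>\<alpha>\<close> and \<open>\<beta>\<close> may be arbitrary words of edges since nonpaths give zero.\<close>

definition monomial :: "'e list \<Rightarrow> 'v set \<Rightarrow> 'e list \<Rightarrow> ('v, 'e) free_elem" where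
  "monomial \<alpha> A \<beta> = prod_list (map edge_gen \<alpha>) * proj_gen A * prod_list (rev (map ghost_gen \<beta>))"

lemma edge_monomial: "edge_gen e * monomial \<alpha> A \<beta> = monomial (e # \<alpha>) A \<beta>"
  by (simp add: monomial_def mult.assoc)

lemma monomial_ghost: "monomial \<alpha> A \<beta> * ghost_gen e = monomial \<alpha> A (e # \<beta>)"
  by (simp add: monomial_def mult.assoc)

lemma monomial_Nil: "monomial [] A [] = proj_gen A"
  by (simp add: monomial_def)

lemma monomial_empty: "monomial \<alpha> {} \<beta> \<approx> 0"
  using J.eqv_mult_right[OF J.eqv_mult_left[OF proj_empty]] unfolding monomial_def by fastforce

text \<open>The edge words survive and only the middle set changes, becoming empty if the product
  vanishes. Keeping zero in this shape keeps the lengths, and hence the degree, under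
  control.\<close>

lemma proj_monomial:
  assumes "A \<in> gen_verts G" "B \<in> gen_verts G" "set \<alpha> \<subseteq> edges G"
  shows "\<exists>C \<in> gen_verts G. proj_gen B * monomial \<alpha> A \<beta> \<approx> monomial \<alpha> C \<beta>"
proof (cases \<alpha>)
  case Nil
  have "proj_gen B * monomial \<alpha> A \<beta> \<approx> monomial \<alpha> (B \<inter> A) \<beta>"
    using J.eqv_mult_right[OF proj_Int[OF assms(2,1)]] Nil by (simp add: monomial_def mult.assoc)
  then show ?thesis using assms gen_Int by blast
next
  case (Cons e \<alpha>')
  have "proj_gen B * monomial \<alpha> A \<beta> = (proj_gen B * edge_gen e) * monomial \<alpha>' A \<beta>"
    by (simp add: Cons mult.assoc flip: edge_monomial)
  also have "\<dots> \<approx> (if src G e \<in> B then edge_gen e else 0) * monomial \<alpha>' A \<beta>"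
    using assms Cons by (intro J.eqv_mult_right proj_edge) auto
  also have "\<dots> \<approx> monomial \<alpha> (if src G e \<in> B then A else {}) \<beta>"
    using J.eqv_sym[OF monomial_empty] by (simp add: Cons edge_monomial)
  finally show ?thesis using assms gen_empty by (auto split: if_splits)
qed

lemma monomial_proj:
  assumes "A \<in> gen_verts G" "B \<in> gen_verts G" "set \<beta> \<subseteq> edges G"
  shows "\<exists>C \<in> gen_verts G. monomial \<alpha> A \<beta> * proj_gen B \<approx> monomial \<alpha> C \<beta>"
proof (cases \<beta>)
  case Nil
  have "monomial \<alpha> A \<beta> * proj_gen B \<approx> monomial \<alpha> (A \<inter> B) \<beta>"
    using J.eqv_mult_left[OF proj_Int[OF assms(1,2)]] Nil by (simp add: monomial_def mult.assoc)
  then show ?thesis using assms gen_Int by blast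
next
  case (Cons e \<beta>')
  have "monomial \<alpha> A \<beta> * proj_gen B = monomial \<alpha> A \<beta>' * (ghost_gen e * proj_gen B)"
    by (simp add: Cons mult.assoc flip: monomial_ghost)
  also have "\<dots> \<approx> monomial \<alpha> A \<beta>' * (if src G e \<in> B then ghost_gen e else 0)"
    using assms Cons by (intro J.eqv_mult_left ghost_proj) auto
  also have "\<dots> \<approx> monomial \<alpha> (if src G e \<in> B then A else {}) \<beta>"
    using J.eqv_sym[OF monomial_empty] by (simp add: Cons monomial_ghost)
  finally show ?thesis using assms gen_empty by (auto split: if_splits)
qed

lemma ghost_monomial_Cons:
  assumes "e \<in> edges G" "A \<in> gen_verts G" "set (f # \<alpha>) \<subseteq> edges G"
  shows "\<exists>C \<in> gen_verts G. ghost_gen e * monomial (f # \<alpha>) A \<beta> \<approx> monomial \<alpha> C \<beta>"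
proof -
  have "ghost_gen e * monomial (f # \<alpha>) A \<beta> = (ghost_gen e * edge_gen f) * monomial \<alpha> A \<beta>"
    by (simp add: mult.assoc flip: edge_monomial)
  also have "\<dots> \<approx> (if e = f then proj_gen (rng G e) else 0) * monomial \<alpha> A \<beta>"
    using assms by (intro J.eqv_mult_right ghost_edge) auto
  finally have *: "ghost_gen e * monomial (f # \<alpha>) A \<beta> \<approx>
      (if e = f then proj_gen (rng G e) else 0) * monomial \<alpha> A \<beta>" .
  show ?thesis
  proof (cases "e = f")
    case True
    obtain C where "C \<in> gen_verts G" "proj_gen (rng G e) * monomial \<alpha> A \<beta> \<approx> monomial \<alpha> C \<beta>"
      using proj_monomial[of A "rng G e" \<alpha> \<beta>] assms gen_range[of e G] by auto
    then show ?thesis using True * J.eqv_trans by auto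
  next
    case False
    then have "ghost_gen e * monomial (f # \<alpha>) A \<beta> \<approx> monomial \<alpha> {} \<beta>"
      using * J.eqv_trans J.eqv_sym[OF monomial_empty] by auto
    then show ?thesis using gen_empty by blast
  qed
qed

lemma monomial_edge_Cons:
  assumes "e \<in> edges G" "A \<in> gen_verts G" "set (f # \<beta>) \<subseteq> edges G"
  shows "\<exists>C \<in> gen_verts G. monomial \<alpha> A (f # \<beta>) * edge_gen e \<approx> monomial \<alpha> C \<beta>"
proof -
  have "monomial \<alpha> A (f # \<beta>) * edge_gen e = monomial \<alpha> A \<beta> * (ghost_gen f * edge_gen e)"
    by (simp add: mult.assoc flip: monomial_ghost)
  also have "\<dots> \<approx> monomial \<alpha> A \<beta> * (if f = e then proj_gen (rng G f) else 0)"
    using assms by (intro J.eqv_mult_left ghost_edge) auto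
  finally have *: "monomial \<alpha> A (f # \<beta>) * edge_gen e \<approx>
      monomial \<alpha> A \<beta> * (if f = e then proj_gen (rng G f) else 0)" .
  show ?thesis
  proof (cases "f = e")
    case True
    obtain C where "C \<in> gen_verts G" "monomial \<alpha> A \<beta> * proj_gen (rng G f) \<approx> monomial \<alpha> C \<beta>"
      using monomial_proj[of A "rng G f" \<beta> \<alpha>] assms gen_range[of f G] by auto
    then show ?thesis using True * J.eqv_trans by auto
  next
    case False
    then have "monomial \<alpha> A (f # \<beta>) * edge_gen e \<approx> monomial \<alpha> {} \<beta>"
      using * J.eqv_trans J.eqv_sym[OF monomial_empty] by auto
    then show ?thesis using gen_empty by blast
  qed
qed

text \<open>With no edge to cancel, the ghost absorbs the set projection and joins the ghost part,
  leaving its range as the middle set. Ghosts are multiplied in reverse order, so the new leftmost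
  factor is the last entry of the list.\<close>

lemma ghost_monomial_Nil:
  assumes "e \<in> edges G" "A \<in> gen_verts G"
  shows "\<exists>C \<in> gen_verts G. ghost_gen e * monomial [] A \<beta> \<approx> monomial [] C (\<beta> @ [e])"
proof (cases "src G e \<in> A")
  case True
  let ?T = "prod_list (rev (map ghost_gen \<beta>)) :: ('v, 'e) free_elem"
  have "ghost_gen e * monomial [] A \<beta> = (ghost_gen e * proj_gen A) * ?T"
    by (simp add: monomial_def mult.assoc)
  also have "\<dots> \<approx> ghost_gen e * ?T"
    using ghost_proj[OF assms] True by (intro J.eqv_mult_right) simp
  also have "\<dots> \<approx> (proj_gen (rng G e) * ghost_gen e) * ?T"
    by (rule J.eqv_mult_right[OF J.eqv_sym[OF proj_rng_ghost[OF assms(1)]]])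
  also have "\<dots> = monomial [] (rng G e) (\<beta> @ [e])" by (simp add: monomial_def mult.assoc)
  finally show ?thesis using gen_range[OF assms(1)] by blast
next
  case False
  have "ghost_gen e * monomial [] A \<beta> = (ghost_gen e * proj_gen A) * prod_list (rev (map ghost_gen \<beta>))"
    by (simp add: monomial_def mult.assoc)
  also have "\<dots> \<approx> 0 * prod_list (rev (map ghost_gen \<beta>))"
    using ghost_proj[OF assms] False by (intro J.eqv_mult_right) simp
  also have "\<dots> \<approx> monomial [] {} (\<beta> @ [e])"
    using J.eqv_sym[OF monomial_empty] by simp
  finally show ?thesis using gen_empty by blast
qed

text \<open>Letters are multiplied on from the left: an edge lengthens \<alpha>, a ghost shortens
  \<alpha> or, if \<alpha> is empty, lengthens \<beta>. The difference of lengths thus follows the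
  degree.\<close>

lemma word_eqv_monomial:
  assumes "w \<noteq> []" "set w \<subseteq> generators G"
  shows "\<exists>\<alpha> A \<beta>. A \<in> gen_verts G \<and> set \<alpha> \<subseteq> edges G \<and> set \<beta> \<subseteq> edges G \<and>
    int (length \<alpha>) = word_degree w + int (length \<beta>) \<and>
    Poly_Mapping.single (Word w) 1 \<approx> monomial \<alpha> A \<beta>"
  using assms
proof (induction w)
  case (Cons g w)
  have g: "g \<in> generators G" using Cons.prems by simp
  show ?case
  proof (cases "w = []")
    case True
    show ?thesis
    proof (cases g)
      case (Edge e)
      have e: "e \<in> edges G" using g Edge by (auto simp: generators_def)
      have "Poly_Mapping.single (Word [Edge e]) 1 \<approx> monomial [e] (rng G e) []"
        using J.eqv_sym[OF edge_proj_rng[OF e]] by (simp add: monomial_def edge_gen_def)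
      then show ?thesis using True Edge e gen_range[OF e]
        by (intro exI[of _ "[e]"] exI[of _ "rng G e"] exI[of _ "[]"]) (simp add: word_degree_def)
    next
      case (Ghost e)
      have e: "e \<in> edges G" using g Ghost by (auto simp: generators_def)
      have "Poly_Mapping.single (Word [Ghost e]) 1 \<approx> monomial [] (rng G e) [e]"
        using J.eqv_sym[OF proj_rng_ghost[OF e]] by (simp add: monomial_def ghost_gen_def)
      then show ?thesis using True Ghost e gen_range[OF e]
        by (intro exI[of _ "[]"] exI[of _ "rng G e"] exI[of _ "[e]"]) (simp add: word_degree_def)
    next
      case (Proj A)
      have "A \<in> gen_verts G" using g Proj by (auto simp: generators_def)
      then show ?thesis using True Proj
        by (intro exI[of _ "[]"] exI[of _ A] exI[of _ "[]"])
          (simp add: word_degree_def monomial_Nil proj_gen_def)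
    qed
  next
    case False
    then obtain \<alpha> A \<beta> where IH: "A \<in> gen_verts G" "set \<alpha> \<subseteq> edges G" "set \<beta> \<subseteq> edges G"
      "int (length \<alpha>) = word_degree w + int (length \<beta>)"
      "Poly_Mapping.single (Word w) 1 \<approx> monomial \<alpha> A \<beta>"
      using Cons by auto
    have "Poly_Mapping.single (Word (g # w)) 1 =
        Poly_Mapping.single (Word [g]) 1 * (Poly_Mapping.single (Word w) 1 :: ('v, 'e) free_elem)"
      by (simp add: mult_single plus_gen_word_def)
    also have "\<dots> \<approx> Poly_Mapping.single (Word [g]) 1 * monomial \<alpha> A \<beta>"
      using IH(5) by (rule J.eqv_mult_left)
    finally have *: "Poly_Mapping.single (Word (g # w)) 1 \<approx> Poly_Mapping.single (Word [g]) 1 * monomial \<alpha> A \<beta>" .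
    show ?thesis
    proof (cases g)
      case (Edge e)
      have e: "e \<in> edges G" using g Edge by (auto simp: generators_def)
      have "Poly_Mapping.single (Word (g # w)) 1 \<approx> monomial (e # \<alpha>) A \<beta>"
        using * Edge by (simp add: edge_monomial flip: edge_gen_def)
      then show ?thesis using Edge e IH(1-4)
        by (intro exI[of _ "e # \<alpha>"] exI[of _ A] exI[of _ \<beta>]) (simp add: word_degree_def)
    next
      case (Proj B)
      have "B \<in> gen_verts G" using g Proj by (auto simp: generators_def)
      then obtain C where C: "C \<in> gen_verts G" "proj_gen B * monomial \<alpha> A \<beta> \<approx> monomial \<alpha> C \<beta>"
        using proj_monomial IH by blast
      have "Poly_Mapping.single (Word (g # w)) 1 \<approx> monomial \<alpha> C \<beta>"
        using J.eqv_trans[OF * ] C(2) Proj by (simp add: proj_gen_def)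
      then show ?thesis using Proj C(1) IH(1-4)
        by (intro exI[of _ \<alpha>] exI[of _ C] exI[of _ \<beta>]) (simp add: word_degree_def)
    next
      case (Ghost e)
      have e: "e \<in> edges G" using g Ghost by (auto simp: generators_def)
      have **: "Poly_Mapping.single (Word (g # w)) 1 \<approx> ghost_gen e * monomial \<alpha> A \<beta>"
        using * Ghost by (simp add: ghost_gen_def)
      show ?thesis
      proof (cases \<alpha>)
        case Nil
        obtain C where C: "C \<in> gen_verts G" "ghost_gen e * monomial \<alpha> A \<beta> \<approx> monomial [] C (\<beta> @ [e])"
          using ghost_monomial_Nil[OF e IH(1)] Nil by blast
        have "Poly_Mapping.single (Word (g # w)) 1 \<approx> monomial [] C (\<beta> @ [e])"
          using J.eqv_trans[OF ** C(2)] .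
        then show ?thesis using Ghost Nil e C(1) IH(2-4)
          by (intro exI[of _ "[]"] exI[of _ C] exI[of _ "\<beta> @ [e]"]) (simp add: word_degree_def)
      next
        case (Cons f \<alpha>')
        obtain C where C: "C \<in> gen_verts G" "ghost_gen e * monomial \<alpha> A \<beta> \<approx> monomial \<alpha>' C \<beta>"
          using ghost_monomial_Cons[OF e IH(1), of f \<alpha>' \<beta>] IH(2) Cons by blast
        have "Poly_Mapping.single (Word (g # w)) 1 \<approx> monomial \<alpha>' C \<beta>"
          using J.eqv_trans[OF ** C(2)] .
        then show ?thesis using Ghost Cons e C(1) IH(2-4)
          by (intro exI[of _ \<alpha>'] exI[of _ C] exI[of _ \<beta>]) (simp add: word_degree_def)
      qed
    qed
  qed
qed simp

text \<open>The degree d is nonnegative, negative degrees being left to the involution. The bound k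
  on the ghost part is the parameter of the induction in degree zero.\<close>

inductive_set monomial_span :: "nat \<Rightarrow> nat \<Rightarrow> ('v, 'e) free_elem set" for d k where
  span_zero: "0 \<in> monomial_span d k"
| span_add_monomial: "\<lbrakk>y \<in> monomial_span d k; A \<in> gen_verts G; set \<alpha> \<subseteq> edges G; set \<beta> \<subseteq> edges G;
    length \<alpha> = d + length \<beta>; length \<beta> \<le> k\<rbrakk> \<Longrightarrow> y + scalar c * monomial \<alpha> A \<beta> \<in> monomial_span d k"

lemma monomial_span_mono: "y \<in> monomial_span d k \<Longrightarrow> k \<le> l \<Longrightarrow> y \<in> monomial_span d l"
  by (induction rule: monomial_span.induct) (auto intro: monomial_span.intros)

lemma scalar_left_commute: "x * (scalar c * y) = scalar c * (x * y)"
  by (metis mult.assoc scalar_commute)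

lemma homogeneous_eqv_span:
  assumes x: "x \<in> free_carrier G" and deg: "\<And>w. w \<in> Poly_Mapping.keys x \<Longrightarrow> word_degree (letters w) = int d"
  shows "\<exists>k. \<exists>y \<in> monomial_span d k. x \<approx> y"
proof (induction x rule: poly_mapping_single_induct)
  case zero
  then show ?case using span_zero by blast
next
  case (single z w c)
  obtain k y where y: "y \<in> monomial_span d k" "z \<approx> y" using single.IH by blast
  have "letters w \<noteq> []" "set (letters w) \<subseteq> generators G"
    using x single.hyps by (auto simp: free_carrier_def)
  then obtain \<alpha> A \<beta> where m: "A \<in> gen_verts G" "set \<alpha> \<subseteq> edges G" "set \<beta> \<subseteq> edges G"
    "int (length \<alpha>) = int d + int (length \<beta>)" "Poly_Mapping.single w 1 \<approx> monomial \<alpha> A \<beta>"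
    using word_eqv_monomial deg[OF single.hyps] by (metis gen_word.collapse)
  have "Poly_Mapping.single w c = scalar c * Poly_Mapping.single w 1"
    by (simp add: scalar_def mult_single)
  then have "z + Poly_Mapping.single w c \<approx> y + scalar c * monomial \<alpha> A \<beta>"
    using y(2) m(5) by (simp add: J.eqv_add J.eqv_mult_left)
  moreover have "y \<in> monomial_span d (max k (length \<beta>))"
    using y(1) by (rule monomial_span_mono) simp
  then have "y + scalar c * monomial \<alpha> A \<beta> \<in> monomial_span d (max k (length \<beta>))"
    using m(1-4) by (intro span_add_monomial) auto
  ultimately show ?case by blast
qed

text \<open>In positive degree every monomial starts with an edge, and the ghost cancels it or gives
  zero; the ghost parts, and with them k, are unchanged.\<close>

lemma ghost_span:
  assumes "y \<in> monomial_span (Suc d) k" "e \<in> edges G"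
  shows "\<exists>z \<in> monomial_span d k. ghost_gen e * y \<approx> z"
  using assms(1)
proof induction
  case span_zero
  then show ?case using monomial_span.span_zero by auto
next
  case (span_add_monomial y A \<alpha> \<beta> c)
  obtain z where z: "z \<in> monomial_span d k" "ghost_gen e * y \<approx> z" using span_add_monomial.IH by blast
  obtain f \<alpha>' where \<alpha>: "\<alpha> = f # \<alpha>'" using span_add_monomial.hyps by (cases \<alpha>) auto
  obtain C where C: "C \<in> gen_verts G" "ghost_gen e * monomial \<alpha> A \<beta> \<approx> monomial \<alpha>' C \<beta>"
    using ghost_monomial_Cons[OF assms(2)] span_add_monomial.hyps \<alpha> by blast
  have "ghost_gen e * (y + scalar c * monomial \<alpha> A \<beta>) \<approx> z + scalar c * monomial \<alpha>' C \<beta>"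
    unfolding distrib_left scalar_left_commute
    using z(2) J.eqv_mult_left[OF C(2)] by (rule J.eqv_add)
  moreover have "z + scalar c * monomial \<alpha>' C \<beta> \<in> monomial_span d k"
    using z(1) C(1) span_add_monomial.hyps \<alpha> by (intro monomial_span.span_add_monomial) auto
  ultimately show ?case by blast
qed

text \<open>A monomial with edges loses one on each side. A set projection is first turned into a
  ghost, which then meets the edge g, so it yields a set projection again.\<close>

lemma ghost_span_edge:
  assumes "y \<in> monomial_span 0 (Suc k)" "e \<in> edges G" "g \<in> edges G"
  shows "\<exists>z \<in> monomial_span 0 k. ghost_gen e * y * edge_gen g \<approx> z"
  using assms(1)
proof induction
  case span_zero
  then show ?case using monomial_span.span_zero by auto
next
  case (span_add_monomial y A \<alpha> \<beta> c)
  obtain z where z: "z \<in> monomial_span 0 k" "ghost_gen e * y * edge_gen g \<approx> z"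
    using span_add_monomial.IH by blast
  have "\<exists>\<alpha>' C \<beta>'. C \<in> gen_verts G \<and> set \<alpha>' \<subseteq> edges G \<and> set \<beta>' \<subseteq> edges G \<and> length \<alpha>' = length \<beta>' \<and>
      length \<beta>' \<le> k \<and> ghost_gen e * monomial \<alpha> A \<beta> * edge_gen g \<approx> monomial \<alpha>' C \<beta>'"
  proof (cases \<alpha>)
    case Nil
    then have Nil: "\<alpha> = []" "\<beta> = []" using span_add_monomial.hyps by auto
    have "\<exists>C \<in> gen_verts G. ghost_gen e * monomial [] A [] \<approx> monomial [] C ([] @ [e])"
      by (rule ghost_monomial_Nil) (use assms span_add_monomial.hyps in auto)
    then obtain B where B: "B \<in> gen_verts G" "ghost_gen e * monomial [] A [] \<approx> monomial [] B [e]" by auto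
    obtain C where C: "C \<in> gen_verts G" "monomial [] B [e] * edge_gen g \<approx> monomial [] C []"
      using monomial_edge_Cons[OF assms(3) B(1), of e "[]" "[]"] assms(2) by auto
    have "ghost_gen e * monomial \<alpha> A \<beta> * edge_gen g \<approx> monomial [] C []"
      using J.eqv_trans[OF J.eqv_mult_right[OF B(2)] C(2)] Nil by simp
    then show ?thesis using C(1)
      by (intro exI[of _ "[]"] exI[of _ C] exI[of _ "[]"]) simp
  next
    case (Cons f \<alpha>')
    then obtain h \<beta>' where \<beta>: "\<beta> = h # \<beta>'" using span_add_monomial.hyps by (cases \<beta>) auto
    obtain B where B: "B \<in> gen_verts G" "ghost_gen e * monomial \<alpha> A \<beta> \<approx> monomial \<alpha>' B \<beta>"
      using ghost_monomial_Cons[OF assms(2)] span_add_monomial.hyps Cons by blast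
    obtain C where C: "C \<in> gen_verts G" "monomial \<alpha>' B \<beta> * edge_gen g \<approx> monomial \<alpha>' C \<beta>'"
      using monomial_edge_Cons[OF assms(3) B(1)] span_add_monomial.hyps \<beta> by blast
    have "ghost_gen e * monomial \<alpha> A \<beta> * edge_gen g \<approx> monomial \<alpha>' C \<beta>'"
      using J.eqv_trans[OF J.eqv_mult_right[OF B(2)] C(2)] .
    then show ?thesis using C(1) span_add_monomial.hyps Cons \<beta>
      by (intro exI[of _ \<alpha>'] exI[of _ C] exI[of _ \<beta>']) simp
  qed
  then obtain \<alpha>' C \<beta>' where m: "C \<in> gen_verts G" "set \<alpha>' \<subseteq> edges G" "set \<beta>' \<subseteq> edges G"
    "length \<alpha>' = length \<beta>'" "length \<beta>' \<le> k"
    "ghost_gen e * monomial \<alpha> A \<beta> * edge_gen g \<approx> monomial \<alpha>' C \<beta>'" by blast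
  have "ghost_gen e * (y + scalar c * monomial \<alpha> A \<beta>) * edge_gen g =
      ghost_gen e * y * edge_gen g + scalar c * (ghost_gen e * monomial \<alpha> A \<beta> * edge_gen g)"
    by (simp add: distrib_left distrib_right scalar_left_commute mult.assoc)
  also have "\<dots> \<approx> z + scalar c * monomial \<alpha>' C \<beta>'"
    using z(2) J.eqv_mult_left[OF m(6)] by (rule J.eqv_add)
  finally have "ghost_gen e * (y + scalar c * monomial \<alpha> A \<beta>) * edge_gen g \<approx> z + scalar c * monomial \<alpha>' C \<beta>'" .
  moreover have "z + scalar c * monomial \<alpha>' C \<beta>' \<in> monomial_span 0 k"
    using z(1) m by (intro monomial_span.span_add_monomial) auto
  ultimately show ?case by blast
qed

text \<open>The projection q of the overview. By orthogonality of its summands it is a left unit for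
  edges in E and a right unit for their ghosts.\<close>

definition edge_proj :: "'e set \<Rightarrow> ('v, 'e) free_elem" where
  "edge_proj E = (\<Sum>e\<in>E. edge_gen e * ghost_gen e)"

lemma edge_proj_edge:
  assumes "finite E" "E \<subseteq> edges G" "e \<in> E"
  shows "edge_proj E * edge_gen e \<approx> edge_gen e"
proof -
  have "edge_proj E * edge_gen e = (\<Sum>f\<in>E. edge_gen f * (ghost_gen f * edge_gen e))"
    by (simp add: edge_proj_def sum_distrib_right mult.assoc)
  also have "\<dots> \<approx> (\<Sum>f\<in>E. edge_gen f * (if f = e then proj_gen (rng G f) else 0))"
    using assms by (intro J.eqv_sum J.eqv_mult_left ghost_edge) auto
  also have "\<dots> = (\<Sum>f\<in>E. if f = e then edge_gen e * proj_gen (rng G e) else 0)"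
    by (rule sum.cong) auto
  also have "\<dots> \<approx> edge_gen e" using assms edge_proj_rng[of e] by auto
  finally show ?thesis .
qed

lemma ghost_edge_proj:
  assumes "finite E" "E \<subseteq> edges G" "e \<in> E"
  shows "ghost_gen e * edge_proj E \<approx> ghost_gen e"
proof -
  have "ghost_gen e * edge_proj E = (\<Sum>f\<in>E. (ghost_gen e * edge_gen f) * ghost_gen f)"
    by (simp add: edge_proj_def sum_distrib_left mult.assoc)
  also have "\<dots> \<approx> (\<Sum>f\<in>E. (if e = f then proj_gen (rng G e) else 0) * ghost_gen f)"
    using assms by (intro J.eqv_sum J.eqv_mult_right ghost_edge) auto
  also have "\<dots> = (\<Sum>f\<in>E. if f = e then proj_gen (rng G e) * ghost_gen e else 0)"
    by (rule sum.cong) auto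
  also have "\<dots> \<approx> ghost_gen e" using assms proj_rng_ghost[of e] by auto
  finally show ?thesis .
qed

text \<open>E collects the first edges of the monomials. Allowing every larger F is what lets the
  induction add another monomial.\<close>

lemma span_Suc_edge_proj:
  assumes "y \<in> monomial_span (Suc d) k"
  shows "\<exists>E. finite E \<and> E \<subseteq> edges G \<and>
    (\<forall>F. finite F \<longrightarrow> E \<subseteq> F \<longrightarrow> F \<subseteq> edges G \<longrightarrow> edge_proj F * y \<approx> y)"
  using assms
proof induction
  case span_zero
  then show ?case by (intro exI[of _ "{}"]) simp
next
  case (span_add_monomial y A \<alpha> \<beta> c)
  obtain E where E: "finite E" "E \<subseteq> edges G"
    "\<And>F. finite F \<Longrightarrow> E \<subseteq> F \<Longrightarrow> F \<subseteq> edges G \<Longrightarrow> edge_proj F * y \<approx> y"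
    using span_add_monomial.IH by blast
  obtain f \<alpha>' where \<alpha>: "\<alpha> = f # \<alpha>'" using span_add_monomial.hyps by (cases \<alpha>) auto
  have "edge_proj F * (y + scalar c * monomial \<alpha> A \<beta>) \<approx> y + scalar c * monomial \<alpha> A \<beta>"
    if F: "finite F" "insert f E \<subseteq> F" "F \<subseteq> edges G" for F
  proof -
    have "edge_proj F * monomial \<alpha> A \<beta> = (edge_proj F * edge_gen f) * monomial \<alpha>' A \<beta>"
      by (simp add: \<alpha> mult.assoc flip: edge_monomial)
    also have "\<dots> \<approx> edge_gen f * monomial \<alpha>' A \<beta>"
      using F by (intro J.eqv_mult_right edge_proj_edge) auto
    finally have "edge_proj F * monomial \<alpha> A \<beta> \<approx> monomial \<alpha> A \<beta>" by (simp add: \<alpha> edge_monomial)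
    then show ?thesis unfolding distrib_left scalar_left_commute
      using E(3) F by (intro J.eqv_add J.eqv_mult_left) auto
  qed
  then show ?case using E(1,2) span_add_monomial.hyps \<alpha>
    by (intro exI[of _ "insert f E"]) auto
qed

section \<open>Combinations of set projections and their values at vertices\<close>

definition diag_sum :: "(complex \<times> 'v set) list \<Rightarrow> ('v, 'e) free_elem" where
  "diag_sum ts = (\<Sum>(c, A) \<leftarrow> ts. scalar c * proj_gen A)"

definition diag_val :: "(complex \<times> 'v set) list \<Rightarrow> 'v \<Rightarrow> complex" where
  "diag_val ts v = (\<Sum>(c, A) \<leftarrow> ts. if v \<in> A then c else 0)"

lemma diag_simps [simp]:
  "diag_sum [] = 0" "diag_sum ((c, A) # ts) = scalar c * proj_gen A + diag_sum ts"
  "diag_val [] v = 0" "diag_val ((c, A) # ts) v = (if v \<in> A then c else 0) + diag_val ts v"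
  by (simp_all add: diag_sum_def diag_val_def)

lemma diag_append:
  "diag_sum (ts @ us) = diag_sum ts + diag_sum us" "diag_val (ts @ us) v = diag_val ts v + diag_val us v"
  by (simp_all add: diag_sum_def diag_val_def)

text \<open>\<open>gen_verts G\<close> has no complements, so a difference of projections stands in
  for the set B - C. The induction removes one set A from the list and splits B - C into the parts
  inside and outside A; c0 accumulates the coefficients of the removed sets that contain the current
  part.\<close>

lemma diag_sum_relative:
  assumes "\<forall>(c, A) \<in> set ts. A \<in> gen_verts G" "B \<in> gen_verts G" "C \<in> gen_verts G" "C \<subseteq> B"
    and "\<forall>v \<in> B - C. c0 + diag_val ts v = 0"
  shows "(proj_gen B - proj_gen C) * (scalar c0 + diag_sum ts) \<in> lpa_ideal_ext G"
  using assms
proof (induction ts arbitrary: B C c0)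
  case Nil
  show ?case
  proof (cases "B = C")
    case True
    then show ?thesis by (simp add: J.zero_mem)
  next
    case False
    then have "c0 = 0" using Nil by auto
    then show ?thesis by (simp add: J.zero_mem)
  qed
next
  case (Cons t ts)
  obtain c A where t: "t = (c, A)" by force
  let ?p = "proj_gen :: 'v set \<Rightarrow> ('v, 'e) free_elem"
  define D where "D = diag_sum ts"
  have A: "A \<in> gen_verts G" using Cons.prems t by auto
  note BC = Cons.prems(2,3)
  \<comment> \<open>The part inside A is ?B1 - ?C1, the part outside is B - ?C2.\<close>
  let ?B1 = "B \<inter> A" and ?C1 = "C \<inter> A" let ?C2 = "C \<union> ?B1"
  have gv: "?B1 \<in> gen_verts G" "?C1 \<in> gen_verts G" "?C2 \<in> gen_verts G"
    using A BC by (auto intro: gen_Int gen_Un)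
  have val: "c0 + ((if v \<in> A then c else 0) + diag_val ts v) = 0" if "v \<in> B" "v \<notin> C" for v
    using Cons.prems(5) that unfolding t diag_simps by blast
  have y1: "(?p ?B1 - ?p ?C1) * (scalar (c0 + c) + D) \<in> lpa_ideal_ext G"
    unfolding D_def by (rule Cons.IH) (use Cons.prems(1,4) gv t val in \<open>force simp: add.assoc\<close>)+
  have y2: "(?p B - ?p ?C2) * (scalar c0 + D) \<in> lpa_ideal_ext G"
  proof -
    have "\<forall>v \<in> B - ?C2. c0 + diag_val ts v = 0"
    proof
      fix v assume "v \<in> B - ?C2"
      then show "c0 + diag_val ts v = 0" using val[of v] by simp
    qed
    then show ?thesis
      unfolding D_def by (intro Cons.IH) (use Cons.prems(1,4) BC gv t in auto)
  qed
  have x1: "?p B * ?p A - ?p ?B1 \<in> lpa_ideal_ext G" using proj_Int[OF BC(1) A] by (simp add: J.eqv_def)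
  have x2: "?p C * ?p A - ?p ?C1 \<in> lpa_ideal_ext G" using proj_Int[OF BC(2) A] by (simp add: J.eqv_def)
  have "C \<inter> ?B1 = ?C1" using Cons.prems(4) by auto
  then have x3: "?p ?C2 - (?p C + ?p ?B1 - ?p ?C1) \<in> lpa_ideal_ext G"
    using proj_Un[OF BC(2) gv(1)] by (simp add: J.eqv_def)
  \<comment> \<open>An exact ring identity: the two induction hypotheses, corrected by multiples of
    the relators in \<open>x1\<close>, \<open>x2\<close> and \<open>x3\<close>.\<close>
  have "(?p B - ?p C) * (scalar c0 + diag_sum (t # ts)) =
      (?p B - ?p ?C2) * (scalar c0 + D) + (?p ?B1 - ?p ?C1) * (scalar (c0 + c) + D) +
      (?p ?C2 - (?p C + ?p ?B1 - ?p ?C1)) * (scalar c0 + D) +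
      scalar c * ((?p B * ?p A - ?p ?B1) - (?p C * ?p A - ?p ?C1))"
    unfolding t diag_simps D_def[symmetric]
    by (simp add: algebra_simps scalar_add scalar_commute[of _ c] scalar_left_commute)
  then show ?case
    using J.add_mem[OF J.add_mem[OF J.add_mem[OF y2 y1] J.mult_right_mem[OF x3]]
      J.mult_left_mem[OF J.diff_mem[OF x1 x2]]] by simp
qed

text \<open>The projection of a set B containing all sets of the list is a unit for the sum, and the
  relative statement applies with C empty and c0 = 0.\<close>

lemma diag_sum_eqv_zero:
  assumes "\<forall>(c, A) \<in> set ts. A \<in> gen_verts G" "\<And>v. diag_val ts v = 0"
  shows "diag_sum ts \<approx> 0"
proof -
  have "\<exists>B \<in> gen_verts G. \<forall>(c, A) \<in> set ts. A \<subseteq> B"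
    using assms(1)
  proof (induction ts)
    case (Cons t ts)
    then obtain B where "B \<in> gen_verts G" "\<forall>(c, A) \<in> set ts. A \<subseteq> B" by auto
    then show ?case using Cons.prems by (intro bexI[of _ "B \<union> snd t"]) (auto intro: gen_Un)
  qed (auto intro: gen_empty)
  then obtain B where B: "B \<in> gen_verts G" "\<forall>(c, A) \<in> set ts. A \<subseteq> B" by blast
  have "proj_gen B * diag_sum ts \<approx> diag_sum ts"
    using B(2) assms(1)
  proof (induction ts)
    case (Cons t ts)
    obtain c A where t: "t = (c, A)" by force
    have "proj_gen B * proj_gen A \<approx> proj_gen (B \<inter> A)" using Cons.prems t B(1) by (intro proj_Int) auto
    moreover have "B \<inter> A = A" using Cons.prems t by auto
    ultimately show ?case unfolding t diag_simps distrib_left scalar_left_commute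
      using Cons by (intro J.eqv_add J.eqv_mult_left) auto
  qed simp
  moreover have "(proj_gen B - proj_gen {}) * (scalar 0 + diag_sum ts) \<approx> (proj_gen B - 0) * diag_sum ts"
    using proj_empty by (intro J.eqv_mult J.eqv_diff) auto
  moreover have "(proj_gen B - proj_gen {}) * (scalar 0 + diag_sum ts) \<approx> 0"
    unfolding J.eqv_zero by (rule diag_sum_relative) (use assms B gen_empty in auto)
  ultimately show ?thesis by (metis J.eqv_sym J.eqv_trans diff_zero)
qed

text \<open>In degree zero a monomial is either a set projection or has edges on both sides. The
  latter make up z, for which the projection of a large enough edge set is a two-sided unit.\<close>

lemma span_decompose:
  assumes "y \<in> monomial_span 0 k"
  shows "\<exists>ts z E. (\<forall>(c, A) \<in> set ts. A \<in> gen_verts G) \<and> y = diag_sum ts + z \<and> (k = 0 \<longrightarrow> z = 0) \<and>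
    finite E \<and> E \<subseteq> edges G \<and>
    (\<forall>F. finite F \<longrightarrow> E \<subseteq> F \<longrightarrow> F \<subseteq> edges G \<longrightarrow> edge_proj F * z * edge_proj F \<approx> z)"
  using assms
proof induction
  case span_zero
  then show ?case by (intro exI[of _ "[]"] exI[of _ 0] exI[of _ "{}"]) simp
next
  case (span_add_monomial y A \<alpha> \<beta> c)
  obtain ts z E where IH: "\<forall>(c, A) \<in> set ts. A \<in> gen_verts G" "y = diag_sum ts + z" "k = 0 \<longrightarrow> z = 0"
    "finite E" "E \<subseteq> edges G"
    "\<And>F. finite F \<Longrightarrow> E \<subseteq> F \<Longrightarrow> F \<subseteq> edges G \<Longrightarrow> edge_proj F * z * edge_proj F \<approx> z"
    using span_add_monomial.IH by blast
  show ?case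
  proof (cases \<alpha>)
    case Nil
    then have "\<beta> = []" using span_add_monomial.hyps by simp
    then have "y + scalar c * monomial \<alpha> A \<beta> = diag_sum ((c, A) # ts) + z"
      using IH(2) Nil by (simp add: monomial_Nil)
    moreover have "\<forall>(c, A) \<in> set ((c, A) # ts). A \<in> gen_verts G" using IH(1) span_add_monomial.hyps by auto
    ultimately show ?thesis using IH(3-) by blast
  next
    case (Cons e \<alpha>')
    then obtain f \<beta>' where \<beta>: "\<beta> = f # \<beta>'" using span_add_monomial.hyps by (cases \<beta>) auto
    have "edge_proj F * (z + scalar c * monomial \<alpha> A \<beta>) * edge_proj F \<approx> z + scalar c * monomial \<alpha> A \<beta>"
      if F: "finite F" "{e, f} \<union> E \<subseteq> F" "F \<subseteq> edges G" for F
    proof -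
      have m: "monomial \<alpha> A \<beta> = edge_gen e * monomial \<alpha>' A \<beta>' * ghost_gen f"
        by (simp add: Cons \<beta> edge_monomial monomial_ghost)
      have "edge_proj F * monomial \<alpha> A \<beta> * edge_proj F =
          (edge_proj F * edge_gen e) * monomial \<alpha>' A \<beta>' * (ghost_gen f * edge_proj F)"
        by (simp add: m mult.assoc)
      also have "\<dots> \<approx> edge_gen e * monomial \<alpha>' A \<beta>' * ghost_gen f"
        using F by (intro J.eqv_mult edge_proj_edge ghost_edge_proj) auto
      finally have "edge_proj F * monomial \<alpha> A \<beta> * edge_proj F \<approx> monomial \<alpha> A \<beta>" by (simp add: m)
      then have "edge_proj F * z * edge_proj F + scalar c * (edge_proj F * monomial \<alpha> A \<beta> * edge_proj F)
          \<approx> z + scalar c * monomial \<alpha> A \<beta>"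
        using IH(6) F by (intro J.eqv_add J.eqv_mult_left) auto
      then show ?thesis by (simp add: distrib_left distrib_right scalar_left_commute mult.assoc)
    qed
    moreover have "y + scalar c * monomial \<alpha> A \<beta> = diag_sum ts + (z + scalar c * monomial \<alpha> A \<beta>)"
      using IH(2) by (simp add: add.assoc)
    moreover have "k \<noteq> 0" using span_add_monomial.hyps \<beta> by auto
    moreover have "finite ({e, f} \<union> E)" "{e, f} \<union> E \<subseteq> edges G"
      using IH(4,5) span_add_monomial.hyps Cons \<beta> by auto
    ultimately show ?thesis using IH(1) by blast
  qed
qed

lemma proj_diag_sum:
  assumes "\<forall>(c, A) \<in> set ts. A \<in> gen_verts G" "v \<in> verts G"
  shows "proj_gen {v} * diag_sum ts \<approx> scalar (diag_val ts v) * proj_gen {v}"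
  using assms(1)
proof (induction ts)
  case (Cons t ts)
  obtain c A where t: "t = (c, A)" by force
  have "proj_gen {v} * proj_gen A \<approx> proj_gen ({v} \<inter> A)"
    using Cons.prems t assms(2) by (intro proj_Int gen_vertex) auto
  also have "\<dots> \<approx> scalar (if v \<in> A then 1 else 0) * proj_gen {v}" using proj_empty by simp
  finally have "scalar c * (proj_gen {v} * proj_gen A) + proj_gen {v} * diag_sum ts \<approx>
      scalar c * (scalar (if v \<in> A then 1 else 0) * proj_gen {v}) + scalar (diag_val ts v) * proj_gen {v}"
    using Cons by (intro J.eqv_add J.eqv_mult_left) auto
  then show ?case
    by (cases "v \<in> A") (simp_all add: t distrib_left distrib_right scalar_left_commute[of "proj_gen {v}"] scalar_add)
qed simp

lemma diag_sum_edge: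
  assumes "\<forall>(c, A) \<in> set ts. A \<in> gen_verts G" "e \<in> edges G"
  shows "diag_sum ts * edge_gen e \<approx> scalar (diag_val ts (src G e)) * edge_gen e"
  using assms(1)
proof (induction ts)
  case (Cons t ts)
  obtain c A where t: "t = (c, A)" by force
  have "proj_gen A * edge_gen e \<approx> (if src G e \<in> A then edge_gen e else 0)"
    using Cons.prems t assms(2) by (intro proj_edge) auto
  then have "scalar c * (proj_gen A * edge_gen e) + diag_sum ts * edge_gen e \<approx>
      scalar c * (if src G e \<in> A then edge_gen e else 0) + scalar (diag_val ts (src G e)) * edge_gen e"
    using Cons by (intro J.eqv_add J.eqv_mult_left) auto
  then show ?case
    by (cases "src G e \<in> A") (simp_all add: t distrib_right scalar_add mult.assoc)
qed simp

lemma diag_sum_edge_proj: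
  assumes "\<forall>(c, A) \<in> set ts. A \<in> gen_verts G" "E \<subseteq> edges G"
  shows "diag_sum ts * edge_proj E \<approx>
    (\<Sum>e\<in>E. scalar (diag_val ts (src G e)) * (edge_gen e * ghost_gen e))"
proof -
  have "diag_sum ts * edge_proj E = (\<Sum>e\<in>E. (diag_sum ts * edge_gen e) * ghost_gen e)"
    by (simp add: edge_proj_def sum_distrib_left mult.assoc)
  also have "\<dots> \<approx> (\<Sum>e\<in>E. (scalar (diag_val ts (src G e)) * edge_gen e) * ghost_gen e)"
    using assms by (intro J.eqv_sum J.eqv_mult_right diag_sum_edge) auto
  finally show ?thesis by (simp add: mult.assoc)
qed

end

section \<open>Homogeneous elements of an ideal without vertex projections\<close>

locale vertex_free_ideal = ultragraph G for G :: "('v, 'e) pre_ultragraph" +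
  fixes K :: "('v, 'e) free_elem set"
  assumes K: "two_sided_ideal K"
    and ideal_subset: "lpa_ideal_ext G \<subseteq> K"
    and vertex_notin: "v \<in> verts G \<Longrightarrow> proj_gen {v} \<notin> K"
begin

lemma K_mult_left: "x \<in> K \<Longrightarrow> a * x \<in> K"
  using K by (rule two_sided_ideal.mult_left_mem)

lemma K_mult_right: "x \<in> K \<Longrightarrow> x * a \<in> K"
  using K by (rule two_sided_ideal.mult_right_mem)

lemma K_eqv: "x \<approx> y \<Longrightarrow> x \<in> K \<Longrightarrow> y \<in> K"
  using ideal_subset two_sided_ideal.diff_mem[OF K, of x "x - y"] unfolding J.eqv_def by auto

lemma scalar_vertex_in_K:
  assumes "v \<in> verts G" "scalar c * proj_gen {v} \<in> K"
  shows "c = 0"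
proof (rule ccontr)
  assume "c \<noteq> 0"
  have "scalar (inverse c) * (scalar c * proj_gen {v}) \<in> K" using assms(2) by (rule K_mult_left)
  then have "proj_gen {v} \<in> K" using \<open>c \<noteq> 0\<close> by (simp add: scalar_mult flip: mult.assoc)
  then show False using vertex_notin assms(1) by blast
qed

lemma diag_val_outside:
  assumes "\<forall>(c, A) \<in> set ts. A \<in> gen_verts G" "v \<notin> verts G"
  shows "diag_val ts v = 0"
  using assms(1)
proof (induction ts)
  case (Cons t ts)
  then show ?case using gen_verts_subset_verts[OF ultragraph_axioms] assms(2)
    by (cases t) auto
qed simp

text \<open>Multiplying by the projection of v leaves the value at v times this projection, so all
  values are zero.\<close>

lemma diag_sum_in_K:
  assumes ts: "\<forall>(c, A) \<in> set ts. A \<in> gen_verts G" and K: "diag_sum ts \<in> K"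
  shows "diag_sum ts \<approx> 0"
proof (rule diag_sum_eqv_zero[OF ts])
  fix v
  show "diag_val ts v = 0"
  proof (cases "v \<in> verts G")
    case True
    show ?thesis
      using scalar_vertex_in_K[OF True K_eqv[OF proj_diag_sum[OF ts True] K_mult_left[OF K]]] .
  qed (rule diag_val_outside[OF ts])
qed

text \<open>The induction on k makes all corners vanish, which determines the non-diagonal part z by
  the values of the diagonal part. These values turn out to be supported on finitely many regular
  vertices, whose relations turn y into a diagonal element with all values zero.\<close>

lemma degree_zero_in_K:
  "y \<in> monomial_span 0 k \<Longrightarrow> y \<in> K \<Longrightarrow> y \<approx> 0"
proof (induction k arbitrary: y)
  case 0
  then obtain ts where "\<forall>(c, A) \<in> set ts. A \<in> gen_verts G" "y = diag_sum ts"
    using span_decompose[of y 0] by auto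
  then show ?case using diag_sum_in_K 0 by blast
next
  case (Suc k)
  obtain ts z E where ts: "\<forall>(c, A) \<in> set ts. A \<in> gen_verts G" and y: "y = diag_sum ts + z"
    and E: "finite E" "E \<subseteq> edges G" and z: "edge_proj E * z * edge_proj E \<approx> z"
    using span_decompose[OF Suc.prems(1)] by blast
  define g where "g = diag_val ts"
  \<comment> \<open>Up to congruence, r is the diagonal part multiplied by
    \<open>edge_proj E\<close>.\<close>
  define r :: "('v, 'e) free_elem" where "r = (\<Sum>e\<in>E. scalar (g (src G e)) * (edge_gen e * ghost_gen e))"
  have corner: "ghost_gen e * y * edge_gen f \<approx> 0" if ef: "e \<in> edges G" "f \<in> edges G" for e f
  proof -
    obtain y' where y': "y' \<in> monomial_span 0 k" "ghost_gen e * y * edge_gen f \<approx> y'"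
      using ghost_span_edge[OF Suc.prems(1) ef] by blast
    have "ghost_gen e * y * edge_gen f \<in> K" using Suc.prems(2) by (intro K_mult_left K_mult_right)
    then have "y' \<approx> 0" using Suc.IH[OF y'(1)] K_eqv[OF y'(2)] by blast
    then show ?thesis using J.eqv_trans[OF y'(2)] by blast
  qed
  have qr: "edge_proj E * r \<approx> r"
  proof -
    have "edge_proj E * r = (\<Sum>e\<in>E. scalar (g (src G e)) * ((edge_proj E * edge_gen e) * ghost_gen e))"
      by (simp add: r_def sum_distrib_left scalar_left_commute mult.assoc)
    also have "\<dots> \<approx> r"
      unfolding r_def using E by (intro J.eqv_sum J.eqv_mult_left J.eqv_mult_right edge_proj_edge)
    finally show ?thesis .
  qed
  \<comment> \<open>With q for \<open>edge_proj E\<close>: as q y q vanishes, z = q z q is minus q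
    times the diagonal part times q, that is, -r.\<close>
  have eq: "y \<approx> diag_sum ts - r"
  proof -
    have "edge_proj E * y * edge_proj E =
        (\<Sum>e\<in>E. \<Sum>f\<in>E. edge_gen e * (ghost_gen e * y * edge_gen f) * ghost_gen f)"
      by (simp add: edge_proj_def sum_distrib_left sum_distrib_right mult.assoc) (rule sum.swap)
    moreover have "(\<Sum>e\<in>E. \<Sum>f\<in>E. edge_gen e * (ghost_gen e * y * edge_gen f) * ghost_gen f) \<in> lpa_ideal_ext G"
    proof (intro J.sum_mem)
      fix e f assume "e \<in> E" "f \<in> E"
      then have "ghost_gen e * y * edge_gen f \<in> lpa_ideal_ext G"
        using E corner by (auto simp: J.eqv_zero)
      then show "edge_gen e * (ghost_gen e * y * edge_gen f) * ghost_gen f \<in> lpa_ideal_ext G"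
        by (rule J.mult_right_mem[OF J.mult_left_mem])
    qed
    ultimately have qyq: "edge_proj E * y * edge_proj E \<approx> 0" by (simp add: J.eqv_zero)
    have "edge_proj E * diag_sum ts * edge_proj E \<approx> edge_proj E * r"
      using J.eqv_mult_left[OF diag_sum_edge_proj[OF ts E(2)], of "edge_proj E"]
      by (simp add: mult.assoc r_def g_def)
    then have qDq: "edge_proj E * diag_sum ts * edge_proj E \<approx> r" using qr by (rule J.eqv_trans)
    have "y = diag_sum ts + z" by (rule y)
    also have "\<dots> \<approx> diag_sum ts + edge_proj E * z * edge_proj E"
      using J.eqv_sym[OF z] by (intro J.eqv_add) auto
    also have "\<dots> = diag_sum ts + (edge_proj E * y * edge_proj E - edge_proj E * diag_sum ts * edge_proj E)"
      by (simp add: y distrib_left distrib_right)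
    also have "\<dots> \<approx> diag_sum ts + (0 - r)"
      using qyq qDq by (intro J.eqv_add J.eqv_diff) auto
    finally show ?thesis by simp
  qed
  \<comment> \<open>Since e is not in E, its ghost kills r, and the vanishing corner at e is the
    value at the source times the range projection. The nonempty range provides a vertex at which to
    test this.\<close>
  have outside: "g (src G e) = 0" if e: "e \<in> edges G" "e \<notin> E" for e
  proof -
    obtain v where v: "v \<in> rng G e" "v \<in> verts G" using rng_nonempty rng_subset_verts e by blast
    have "ghost_gen e * r \<approx> 0"
    proof -
      have "ghost_gen e * r = (\<Sum>f\<in>E. scalar (g (src G f)) * ((ghost_gen e * edge_gen f) * ghost_gen f))"
        by (simp add: r_def sum_distrib_left scalar_left_commute mult.assoc)
      also have "\<dots> \<approx> (\<Sum>f\<in>E. scalar (g (src G f)) * ((if e = f then proj_gen (rng G e) else 0) * ghost_gen f))"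
        using E e by (intro J.eqv_sum J.eqv_mult_left J.eqv_mult_right ghost_edge) auto
      also have "\<dots> = 0" using e by (intro sum.neutral) auto
      finally show ?thesis .
    qed
    from J.eqv_mult_right[OF this, of "edge_gen e"] have r0: "ghost_gen e * r * edge_gen e \<approx> 0" by simp
    have gg: "ghost_gen e * edge_gen e \<approx> proj_gen (rng G e)" using ghost_edge[OF e(1) e(1)] by simp
    have D: "ghost_gen e * diag_sum ts * edge_gen e \<approx> scalar (g (src G e)) * proj_gen (rng G e)"
    proof -
      have "ghost_gen e * (diag_sum ts * edge_gen e) \<approx> ghost_gen e * (scalar (g (src G e)) * edge_gen e)"
        unfolding g_def by (rule J.eqv_mult_left[OF diag_sum_edge[OF ts e(1)]])
      also have "\<dots> = scalar (g (src G e)) * (ghost_gen e * edge_gen e)" by (rule scalar_left_commute)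
      also have "\<dots> \<approx> scalar (g (src G e)) * proj_gen (rng G e)" by (rule J.eqv_mult_left[OF gg])
      finally show ?thesis by (simp add: mult.assoc)
    qed
    have "0 \<approx> ghost_gen e * y * edge_gen e" by (rule J.eqv_sym[OF corner[OF e(1) e(1)]])
    also have "\<dots> \<approx> ghost_gen e * (diag_sum ts - r) * edge_gen e"
      by (rule J.eqv_mult_right[OF J.eqv_mult_left[OF eq]])
    also have "\<dots> = ghost_gen e * diag_sum ts * edge_gen e - ghost_gen e * r * edge_gen e"
      by (simp add: left_diff_distrib right_diff_distrib)
    also have "\<dots> \<approx> scalar (g (src G e)) * proj_gen (rng G e) - 0"
      by (rule J.eqv_diff[OF D r0])
    finally have 1: "0 \<approx> scalar (g (src G e)) * proj_gen (rng G e)" by simp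
    have "0 \<approx> proj_gen {v} * (scalar (g (src G e)) * proj_gen (rng G e))"
      using J.eqv_mult_left[OF 1, of "proj_gen {v}"] by simp
    also have "\<dots> = scalar (g (src G e)) * (proj_gen {v} * proj_gen (rng G e))"
      by (rule scalar_left_commute)
    also have "\<dots> \<approx> scalar (g (src G e)) * proj_gen ({v} \<inter> rng G e)"
      using v e by (intro J.eqv_mult_left proj_Int gen_vertex gen_range)
    also have "{v} \<inter> rng G e = {v}" using v by auto
    finally have "scalar (g (src G e)) * proj_gen {v} \<in> K"
      using K_eqv[of 0] ideal_subset J.zero_mem by blast
    then show ?thesis by (rule scalar_vertex_in_K[OF v(2)])
  qed
  \<comment> \<open>No edge starts at v, so its projection kills r and sends y to the value at v
    times itself.\<close>
  have sinks: "g v = 0" if v: "v \<in> verts G" "out_edges G {v} = {}" for v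
  proof -
    have "proj_gen {v} * r \<approx> 0"
    proof -
      have "proj_gen {v} * r = (\<Sum>e\<in>E. scalar (g (src G e)) * ((proj_gen {v} * edge_gen e) * ghost_gen e))"
        by (simp add: r_def sum_distrib_left scalar_left_commute mult.assoc)
      also have "\<dots> \<approx> (\<Sum>e\<in>E. scalar (g (src G e)) * ((if src G e \<in> {v} then edge_gen e else 0) * ghost_gen e))"
        using E v by (intro J.eqv_sum J.eqv_mult_left J.eqv_mult_right proj_edge gen_vertex) auto
      also have "\<dots> = 0" using v E by (intro sum.neutral) (auto simp: out_edges_def)
      finally show ?thesis .
    qed
    then have "proj_gen {v} * diag_sum ts - proj_gen {v} * r \<approx> scalar (g v) * proj_gen {v} - 0"
      unfolding g_def using proj_diag_sum[OF ts v(1)] by (intro J.eqv_diff) auto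
    then have "proj_gen {v} * (diag_sum ts - r) \<approx> scalar (g v) * proj_gen {v}"
      by (simp add: right_diff_distrib)
    then have "scalar (g v) * proj_gen {v} \<in> K"
      using K_eqv[OF J.eqv_trans[OF J.eqv_mult_left[OF eq]]] K_mult_left[OF Suc.prems(2)] by blast
    then show ?thesis by (rule scalar_vertex_in_K[OF v(1)])
  qed
  define V where "V = {v \<in> src G ` E. g v \<noteq> 0}"
  have V: "finite V" "V \<subseteq> verts G" using E src_in_verts by (auto simp: V_def)
  have g0: "g v = 0" if "v \<notin> V" for v
  proof (cases "v \<in> verts G \<and> out_edges G {v} \<noteq> {}")
    case True
    then obtain e where "e \<in> edges G" "src G e = v" by (auto simp: out_edges_def)
    then show ?thesis using outside[of e] that by (auto simp: V_def)
  next
    case False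
    then show ?thesis using sinks[of v] diag_val_outside[OF ts, of v] by (auto simp: g_def)
  qed
  \<comment> \<open>An edge of v outside E would make g vanish at v by \<open>outside\<close>; so v
    emits only edges of E and is regular.\<close>
  have out: "out_edges G {v} = {e \<in> E. src G e = v}" if "v \<in> V" for v
    using E(2) that outside unfolding out_edges_def V_def by force
  have r: "r \<approx> (\<Sum>v\<in>V. scalar (g v) * proj_gen {v})"
  proof -
    have "r = (\<Sum>v \<in> src G ` E. \<Sum>e \<in> {e \<in> E. src G e = v}. scalar (g (src G e)) * (edge_gen e * ghost_gen e))"
      unfolding r_def by (rule sum.image_gen[OF E(1)])
    also have "\<dots> = (\<Sum>v \<in> V. \<Sum>e \<in> {e \<in> E. src G e = v}. scalar (g (src G e)) * (edge_gen e * ghost_gen e))"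
      using E(1) by (intro sum.mono_neutral_right) (auto simp: V_def intro!: sum.neutral)
    also have "\<dots> = (\<Sum>v \<in> V. scalar (g v) * (\<Sum>e \<in> out_edges G {v}. edge_gen e * ghost_gen e))"
      by (intro sum.cong refl) (simp add: out sum_distrib_left)
    also have "\<dots> \<approx> (\<Sum>v\<in>V. scalar (g v) * proj_gen {v})"
    proof (intro J.eqv_sum J.eqv_mult_left)
      fix v assume v: "v \<in> V"
      have "out_edges G {v} \<noteq> {}" using v out[OF v] by (auto simp: V_def)
      then have "is_regular G v" using v V out[OF v] E(1) by (auto simp: is_regular_def)
      then show "(\<Sum>e \<in> out_edges G {v}. edge_gen e * ghost_gen e) \<approx> proj_gen {v}"
        by (rule J.eqv_sym[OF proj_regular])
    qed
    finally show ?thesis .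
  qed
  obtain vs where vs: "set vs = V" "distinct vs" using finite_distinct_list[OF V(1)] by blast
  \<comment> \<open>The combination of vertex projections that replaces -r, written as a list so
    that the whole of y becomes one diagonal sum.\<close>
  define us where "us = map (\<lambda>v. (- g v, {v})) vs"
  have us: "\<forall>(c, A) \<in> set us. A \<in> gen_verts G" using V vs by (auto simp: us_def intro: gen_vertex)
  have "diag_sum us = (\<Sum>v\<in>V. scalar (- g v) * proj_gen {v})"
    by (simp add: us_def diag_sum_def o_def sum_list_distinct_conv_sum_set[OF vs(2)] vs(1))
  then have sum_us: "diag_sum us = - (\<Sum>v\<in>V. scalar (g v) * proj_gen {v})"
    by (simp add: scalar_minus sum_negf)
  have "diag_val us v = (\<Sum>w\<in>V. if v = w then - g w else 0)" for v
    by (simp add: us_def diag_val_def o_def sum_list_distinct_conv_sum_set[OF vs(2)] vs(1))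
  then have val_us: "diag_val us v = - g v" for v using V(1) g0[of v] by auto
  have "y \<approx> diag_sum ts - (\<Sum>v\<in>V. scalar (g v) * proj_gen {v})"
    using eq J.eqv_diff[OF J.eqv_refl r] by (rule J.eqv_trans)
  also have "\<dots> = diag_sum (ts @ us)" by (simp add: diag_append sum_us)
  also have "\<dots> \<approx> 0"
    by (rule diag_sum_eqv_zero) (use ts us val_us in \<open>auto simp: diag_append g_def\<close>)
  finally show ?case .
qed

text \<open>Each \<open>s\<^sub>e\<^sup>* y\<close> has smaller degree and still lies in K, so it
  vanishes by induction; y is congruent to the sum of the
  \<open>s\<^sub>e s\<^sub>e\<^sup>* y\<close> over a finite set E.\<close>

lemma nonneg_degree_in_K:
  "y \<in> monomial_span d k \<Longrightarrow> y \<in> K \<Longrightarrow> y \<approx> 0"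
proof (induction d arbitrary: y)
  case 0
  then show ?case by (rule degree_zero_in_K)
next
  case (Suc d)
  obtain E where E: "finite E" "E \<subseteq> edges G" "edge_proj E * y \<approx> y"
    using span_Suc_edge_proj[OF Suc.prems(1)] by blast
  have "ghost_gen e * y \<in> lpa_ideal_ext G" if e: "e \<in> E" for e
  proof -
    obtain z where z: "z \<in> monomial_span d k" "ghost_gen e * y \<approx> z"
      using ghost_span[OF Suc.prems(1)] E e by blast
    then have "z \<approx> 0" using Suc.IH K_eqv[OF z(2) K_mult_left[OF Suc.prems(2)]] by blast
    then show ?thesis using J.eqv_mem[OF z(2)] by (simp add: J.eqv_zero)
  qed
  then have "edge_proj E * y \<in> lpa_ideal_ext G"
    unfolding edge_proj_def sum_distrib_right mult.assoc
    by (rule J.sum_mem[OF J.mult_left_mem])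
  then show ?case using J.eqv_mem[OF E(3)] by (simp add: J.eqv_zero)
qed

end

lemma keys_free_star:
  "w \<in> Poly_Mapping.keys (free_star x) \<Longrightarrow> \<exists>u \<in> Poly_Mapping.keys x. w = word_star u"
  using keys_sum[of "\<lambda>w. Poly_Mapping.single (word_star w) (cnj (Poly_Mapping.lookup x w))" "Poly_Mapping.keys x"]
  by (auto simp: free_star_def split: if_splits)

lemma gen_degree_star: "gen_degree (gen_star g) = - gen_degree g"
  by (cases g) simp_all

lemma word_degree_star: "word_degree (letters (word_star w)) = - word_degree (letters w)"
proof -
  have "word_degree (rev (map gen_star u)) = - word_degree u" for u :: "('a, 'b) generator list"
    by (induction u) (simp_all add: word_degree_def gen_degree_star)
  then show ?thesis by (simp add: word_star_def)
qed

text \<open>The involution reverses the degree and preserves both K and the defining ideal, so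
  negative degrees reduce to positive ones.\<close>

lemma (in vertex_free_ideal) homogeneous_in_K:
  assumes star: "\<And>x. x \<in> K \<Longrightarrow> free_star x \<in> K"
    and x: "x \<in> free_carrier G" "x \<in> K"
    and deg: "\<And>w. w \<in> Poly_Mapping.keys x \<Longrightarrow> word_degree (letters w) = n"
  shows "x \<in> lpa_ideal G"
proof -
  have nonneg: "x \<in> lpa_ideal G"
    if nn: "x \<in> free_carrier G" "x \<in> K" "\<And>w. w \<in> Poly_Mapping.keys x \<Longrightarrow> word_degree (letters w) = int d" for x d
  proof -
    obtain k y where y: "y \<in> monomial_span d k" "x \<approx> y"
      using homogeneous_eqv_span[OF nn(1,3)] by blast
    then have "y \<approx> 0" using nonneg_degree_in_K K_eqv nn(2) by blast
    then have "x \<in> lpa_ideal_ext G" using J.eqv_mem[OF y(2)] by (simp add: J.eqv_zero)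
    then show ?thesis using lpa_ideal_ext_iff[OF nn(1)] by blast
  qed
  show ?thesis
  proof (cases "n \<ge> 0")
    case True
    then show ?thesis using nonneg[OF x, of "nat n"] deg by simp
  next
    case False
    have "word_degree (letters w) = int (nat (- n))" if "w \<in> Poly_Mapping.keys (free_star x)" for w
      using keys_free_star[OF that] deg False by (auto simp: word_degree_star)
    then have "free_star x \<in> lpa_ideal G"
      using nonneg free_carrier_star x star by blast
    then show ?thesis using lpa_ideal_star by fastforce
  qed
qed

lemma hom_part_carrier: "x \<in> free_carrier G \<Longrightarrow> hom_part n x \<in> free_carrier G"
  using keys_hom_part[of _ n x] by (auto simp: free_carrier_def)

lemma (in rfd_ultragraph) rep_kernel_carrier:
  assumes x: "x \<in> free_carrier G" "x \<in> rep_kernel G"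
  shows "x \<in> lpa_ideal G"
proof -
  interpret V: vertex_free_ideal G "rep_kernel G"
    by (intro vertex_free_ideal.intro vertex_free_ideal_axioms.intro ultragraph_axioms
        two_sided_ideal_rep_kernel lpa_ideal_ext_subset_rep_kernel vertex_notin_rep_kernel)
  have "hom_part n x \<in> lpa_ideal G" for n
    using x keys_hom_part[of _ n x]
    by (intro V.homogeneous_in_K[of _ n] rep_kernel_star hom_part_carrier rep_kernel_hom_part) auto
  moreover have "(\<Sum>n\<in>N. f n) \<in> lpa_ideal G" if "\<And>n. f n \<in> lpa_ideal G" for f and N :: "int set"
    by (induction N rule: infinite_finite_induct) (auto simp: that ideal_zero ideal_add)
  ultimately show ?thesis by (metis sum_hom_part)
qed

section \<open>The quotient algebra\<close>

context ultragraph
begin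

lemma mem_lpa_class: "x \<in> free_carrier G \<Longrightarrow> x \<in> lpa_class G x"
  by (simp add: lpa_class_def ideal_zero)

lemma lpa_class_eq_iff:
  assumes "x \<in> free_carrier G" "y \<in> free_carrier G"
  shows "lpa_class G x = lpa_class G y \<longleftrightarrow> x - y \<in> lpa_ideal G"
proof
  assume "lpa_class G x = lpa_class G y"
  then have "x \<in> lpa_class G y" using mem_lpa_class[OF assms(1)] by simp
  then show "x - y \<in> lpa_ideal G" by (simp add: lpa_class_def)
next
  assume xy: "x - y \<in> lpa_ideal G"
  have "z - x \<in> lpa_ideal G \<longleftrightarrow> z - y \<in> lpa_ideal G" for z
    using ideal_add[of "z - x" G "x - y"] lpa_ideal_diff[of "z - y" G "x - y"] xy by auto
  then show "lpa_class G x = lpa_class G y" by (simp add: lpa_class_def)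
qed

text \<open>The operations on classes are unions over representatives. If every representative
  yields C, the union is C because a class is nonempty.\<close>

lemma UN_lpa_class:
  assumes "x \<in> free_carrier G" "\<And>x'. x' \<in> free_carrier G \<Longrightarrow> x' - x \<in> lpa_ideal G \<Longrightarrow> F x' = C"
  shows "(\<Union>x' \<in> lpa_class G x. F x') = C"
proof -
  have "F x' = C" if "x' \<in> lpa_class G x" for x' using that assms(2) by (simp add: lpa_class_def)
  then show ?thesis using mem_lpa_class[OF assms(1)] by auto
qed

abbreviation "L \<equiv> leavitt_path_algebra G"

lemma lpa_add:
  assumes "x \<in> free_carrier G" "y \<in> free_carrier G"
  shows "alg_add L (lpa_class G x) (lpa_class G y) = lpa_class G (x + y)"
  unfolding leavitt_path_algebra_def star_algebra.simps
proof (intro UN_lpa_class assms)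
  fix x' y' assume "x' \<in> free_carrier G" "x' - x \<in> lpa_ideal G" "y' \<in> free_carrier G" "y' - y \<in> lpa_ideal G"
  then show "lpa_class G (x' + y') = lpa_class G (x + y)"
    using ideal_add[of "x' - x" G "y' - y"] assms
    by (simp add: lpa_class_eq_iff free_carrier_add algebra_simps)
qed

lemma lpa_mult:
  assumes "x \<in> free_carrier G" "y \<in> free_carrier G"
  shows "alg_mult L (lpa_class G x) (lpa_class G y) = lpa_class G (x * y)"
  unfolding leavitt_path_algebra_def star_algebra.simps
proof (intro UN_lpa_class assms)
  fix x' y' assume "x' \<in> free_carrier G" "x' - x \<in> lpa_ideal G" "y' \<in> free_carrier G" "y' - y \<in> lpa_ideal G"
  then show "lpa_class G (x' * y') = lpa_class G (x * y)"
    using ideal_add[OF ideal_mult_right[of "x' - x" G y'] ideal_mult_left[of x G "y' - y"]] assms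
    by (simp add: lpa_class_eq_iff free_carrier_mult algebra_simps)
qed

lemma lpa_scale:
  assumes "x \<in> free_carrier G"
  shows "alg_scale L c (lpa_class G x) = lpa_class G (free_scale c x)"
  unfolding leavitt_path_algebra_def star_algebra.simps
proof (intro UN_lpa_class assms)
  fix x' assume "x' \<in> free_carrier G" "x' - x \<in> lpa_ideal G"
  then show "lpa_class G (free_scale c x') = lpa_class G (free_scale c x)"
    using ideal_scale[of "x' - x" G c] assms
    by (simp add: lpa_class_eq_iff free_carrier_scale) (simp add: free_scale_eq algebra_simps)
qed

lemma lpa_star:
  assumes "x \<in> free_carrier G"
  shows "alg_star L (lpa_class G x) = lpa_class G (free_star x)"
  unfolding leavitt_path_algebra_def star_algebra.simps
proof (intro UN_lpa_class assms)
  fix x' assume "x' \<in> free_carrier G" "x' - x \<in> lpa_ideal G"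
  then show "lpa_class G (free_star x') = lpa_class G (free_star x)"
    using lpa_ideal_star[of "x' - x" G] assms
    by (simp add: lpa_class_eq_iff free_carrier_star free_star_diff)
qed

lemma lpa_zero: "alg_zero L = lpa_class G 0"
  by (simp add: leavitt_path_algebra_def)

lemma lpa_carrier: "alg_carrier L = lpa_class G ` free_carrier G"
  by (simp add: leavitt_path_algebra_def)

lemma free_scale_simps:
  "free_scale 1 x = x" "x + free_scale (- 1) x = 0" "free_scale c (free_scale d x) = free_scale (c * d) x"
  "free_scale c (x + y) = free_scale c x + free_scale c y"
  "free_scale (c + d) x = free_scale c x + free_scale d x"
  "free_scale c x * y = free_scale c (x * y)" "x * free_scale c y = free_scale c (x * y)"
  "free_star (free_scale c x) = free_scale (cnj c) (free_star x)"
proof -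
  show "free_scale 1 x = x" "x + free_scale (- 1) x = 0" "free_scale c (x + y) = free_scale c x + free_scale c y"
    "free_scale (c + d) x = free_scale c x + free_scale d x" "free_scale c x * y = free_scale c (x * y)"
    by (simp_all add: free_scale_eq scalar_minus scalar_add distrib_left distrib_right mult.assoc)
  show "free_scale c (free_scale d x) = free_scale (c * d) x"
    unfolding free_scale_eq scalar_mult[symmetric] by (simp only: mult.assoc)
  show "x * free_scale c y = free_scale c (x * y)"
    unfolding free_scale_eq by (rule scalar_left_commute)
  show "free_star (free_scale c x) = free_scale (cnj c) (free_star x)"
    unfolding free_scale_eq free_star_mult free_star_scalar by (rule scalar_commute)
qed

lemma complex_star_algebra_lpa: "complex_star_algebra L"
  by unfold_locales
    (auto simp: lpa_carrier lpa_zero lpa_add lpa_mult lpa_scale lpa_star free_carrier_zero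
      free_carrier_add free_carrier_mult free_carrier_scale free_carrier_star
      free_star_add free_star_mult free_scale_simps algebra_simps)

end

section \<open>Finite-dimensional representations\<close>

lemma mat_adjoint_index:
  assumes "A \<in> carrier_mat n n" "i < n" "j < n"
  shows "mat_adjoint A $$ (i, j) = conjugate (A $$ (j, i))"
  using assms by (simp add: mat_adjoint_def mat_of_rows_def)

context boundary_rep
begin

definition enum_path :: "nat \<Rightarrow> 'b list" where
  "enum_path = (SOME h. bij_betw h {..<card X} X)"

lemma enum_path: "bij_betw enum_path {..<card X} X"
proof -
  have "\<exists>h. bij_betw h {..<card X} X"
    using ex_bij_betw_nat_finite[OF finite_X] by (simp add: lessThan_atLeast0)
  then show ?thesis unfolding enum_path_def by (rule someI_ex)
qed

lemma enum_path_mem: "i < card X \<Longrightarrow> enum_path i \<in> X"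
  using enum_path by (auto simp: bij_betw_def)

definition rep_mat :: "('a, 'b) free_elem \<Rightarrow> complex mat" where
  "rep_mat x = mat (card X) (card X) (\<lambda>(i, j). rep G A z (enum_path i) (enum_path j) x)"

lemma rep_mat_carrier [simp]: "rep_mat x \<in> carrier_mat (card X) (card X)"
  by (simp add: rep_mat_def)

lemma rep_mat_add: "rep_mat (x + y) = rep_mat x + rep_mat y"
  by (rule eq_matI) (simp_all add: rep_mat_def rep_add)

lemma rep_mat_scale: "rep_mat (free_scale c x) = c \<cdot>\<^sub>m rep_mat x"
  by (rule eq_matI) (simp_all add: rep_mat_def free_scale_eq rep_scalar enum_path_mem)

lemma rep_mat_mult: "rep_mat (x * y) = rep_mat x * rep_mat y"
proof (rule eq_matI)
  fix i j assume "i < dim_row (rep_mat x * rep_mat y)" "j < dim_col (rep_mat x * rep_mat y)"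
  then have ij: "i < card X" "j < card X" by (simp_all add: rep_mat_def)
  have "rep_mat (x * y) $$ (i, j) = (\<Sum>\<gamma>\<in>X. rep G A z (enum_path i) \<gamma> x * rep G A z \<gamma> (enum_path j) y)"
    using ij by (simp add: rep_mat_def rep_mult enum_path_mem)
  also have "\<dots> = (\<Sum>k<card X. rep G A z (enum_path i) (enum_path k) x * rep G A z (enum_path k) (enum_path j) y)"
    by (rule sum.reindex_bij_betw[OF enum_path, symmetric])
  also have "\<dots> = (rep_mat x * rep_mat y) $$ (i, j)"
    using ij by (simp add: rep_mat_def scalar_prod_def lessThan_atLeast0)
  finally show "rep_mat (x * y) $$ (i, j) = (rep_mat x * rep_mat y) $$ (i, j)" .
qed (simp_all add: rep_mat_def)

lemma rep_mat_star: "rep_mat (free_star x) = mat_adjoint (rep_mat x)"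
proof (rule eq_matI)
  have dim: "dim_row (mat_adjoint (rep_mat x)) = card X" "dim_col (mat_adjoint (rep_mat x)) = card X"
    by (simp_all add: mat_adjoint_def rep_mat_def)
  {
    fix i j assume "i < dim_row (mat_adjoint (rep_mat x))" "j < dim_col (mat_adjoint (rep_mat x))"
    then have ij: "i < card X" "j < card X" by (simp_all add: dim)
    then show "rep_mat (free_star x) $$ (i, j) = mat_adjoint (rep_mat x) $$ (i, j)"
      by (simp add: mat_adjoint_index[OF rep_mat_carrier]) (simp add: rep_mat_def rep_star enum_path_mem)
  }
  show "dim_row (rep_mat (free_star x)) = dim_row (mat_adjoint (rep_mat x))"
    "dim_col (rep_mat (free_star x)) = dim_col (mat_adjoint (rep_mat x))"
    by (simp_all add: dim) (simp_all add: rep_mat_def)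
qed

text \<open>An arbitrary representative serves, since the ideal acts as zero.\<close>

definition lpa_rep :: "('a, 'b) free_elem set \<Rightarrow> complex mat" where
  "lpa_rep Y = rep_mat (SOME x. x \<in> Y)"

lemma lpa_rep_class:
  assumes "x \<in> free_carrier G"
  shows "lpa_rep (lpa_class G x) = rep_mat x"
proof -
  define y where "y = (SOME y. y \<in> lpa_class G x)"
  have "y \<in> lpa_class G x" unfolding y_def using mem_lpa_class[OF assms] by (rule someI)
  then have "y - x \<in> lpa_ideal G" by (simp add: lpa_class_def)
  then have "rep G A z \<alpha> \<beta> y = rep G A z \<alpha> \<beta> x" if "\<alpha> \<in> X" "\<beta> \<in> X" for \<alpha> \<beta>
    using rep_ideal[of "y - x" \<alpha> \<beta>] that by (simp add: rep_diff)
  then have "rep_mat y = rep_mat x"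
    by (intro eq_matI) (simp_all add: rep_mat_def enum_path_mem)
  then show ?thesis by (simp add: lpa_rep_def y_def)
qed

lemma lpa_rep_star_hom: "lpa_rep \<in> star_hom L (operator_algebra (card X))"
  by (auto simp: star_hom_def operator_algebra_def lpa_carrier lpa_add lpa_mult lpa_scale lpa_star
      lpa_rep_class free_carrier_add free_carrier_mult free_carrier_scale free_carrier_star
      rep_mat_add rep_mat_mult rep_mat_scale rep_mat_star)

lemma rep_mat_nonzero:
  assumes "\<alpha> \<in> X" "\<beta> \<in> X" "rep G A z \<alpha> \<beta> x \<noteq> 0"
  shows "rep_mat x \<noteq> 0\<^sub>m (card X) (card X)"
proof
  assume 0: "rep_mat x = 0\<^sub>m (card X) (card X)"
  obtain i j where ij: "i < card X" "j < card X" "enum_path i = \<alpha>" "enum_path j = \<beta>"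
  proof -
    have "\<alpha> \<in> enum_path ` {..<card X}" "\<beta> \<in> enum_path ` {..<card X}"
      using bij_betw_imp_surj_on[OF enum_path] assms(1,2) by simp_all
    then show ?thesis using that by auto
  qed
  have "rep_mat x $$ (i, j) = 0" using 0 ij by simp
  then show False using ij assms(3) by (simp add: rep_mat_def)
qed

end

theorem corollary6p2:
  fixes G :: "('v, 'e) pre_ultragraph"
  assumes "ultragraph G"
    and "no_infinite_receivers G"
    and "no_cycle_has_exit G"
    and "no_infinite_backward_chains G"
    and "all_vertices_reach G"
  shows "star_rfd (leavitt_path_algebra G)"
proof -
  interpret rfd_ultragraph G
    by (intro rfd_ultragraph.intro rfd_ultragraph_axioms.intro assms)
  have "\<exists>n. \<exists>\<pi> \<in> star_hom L (operator_algebra n). \<pi> a \<noteq> alg_zero (operator_algebra n)"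
    if a: "a \<in> alg_carrier L" "a \<noteq> alg_zero L" for a
  proof -
    obtain x where x: "x \<in> free_carrier G" "a = lpa_class G x" using a by (auto simp: lpa_carrier)
    have "x \<notin> lpa_ideal G" using a(2) x lpa_class_eq_iff[OF x(1) free_carrier_zero] by (simp add: lpa_zero)
    \<comment> \<open>An element outside the ideal is thus detected by a matrix entry in one of the
      boundary representations.\<close>
    then have "x \<notin> rep_kernel G" using rep_kernel_carrier[OF x(1)] by blast
    then obtain A z \<alpha> \<beta> where A: "prime_boundary G A" "A \<subseteq> verts G" "cmod z = 1"
      and \<alpha>\<beta>: "\<alpha> \<in> boundary_paths G A" "\<beta> \<in> boundary_paths G A" "rep G A z \<alpha> \<beta> x \<noteq> 0"
      unfolding rep_kernel_def by blast
    interpret B: boundary_rep G A z using A by (rule boundary_rep)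
    have "B.lpa_rep a \<noteq> alg_zero (operator_algebra (card (boundary_paths G A)))"
      using B.rep_mat_nonzero[OF \<alpha>\<beta>] B.lpa_rep_class[OF x(1)] x(2) by (simp add: operator_algebra_def)
    then show ?thesis using B.lpa_rep_star_hom by blast
  qed
  then show ?thesis using complex_star_algebra_lpa by (simp add: star_rfd_def)
qed

end
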